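(* The squarefree decomposition problem (SDP) is deterministically polynomial-time reducible to the modular tetration problem (MTP). That is, there is a deterministic algorithm which, given $N\in\mathbb{N}$ and access to an oracle solving MTP, computes the squarefree part of $N$ using a number of bit operations and oracle calls (on inputs of polynomial size) that is polynomial in $\log N$.
   Context: For $a\in\mathbb{N}$ define tetration by ${}^0a=1$ and ${}^{k}a=a^{({}^{k-1}a)}$ for $k\in\mathbb{N}$. The modular tetration problem (MTP): given $a,k,N\in\mathbb{N}$ (encoded in binary), compute ${}^k a \bmod N$. The squarefree part of $N\in\mathbb{N}$ is the smallest natural number $r$ such that $N/r$ is a perfect square. The squarefree decomposition problem (SDP): given $N$, compute its squarefree part. "Polynomial time" is measured in the bit length of the input. *)

theory Defs
  imports
    Complex_Main
    "HOL-Library.Log_Nat"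
    "HOL-Computational_Algebra.Polynomial"
    "HOL-Computational_Algebra.Squarefree"
begin

subsection \<open>The two computational problems\<close>

text \<open>
  A problem is a partial function from instances (tuples of natural numbers) to answers;
  it is undefined on tuples that are not instances. Throughout, the instances consist of
  positive integers.
\<close>

type_synonym problem = "nat list \<Rightarrow> nat option"

primrec tetration :: "nat \<Rightarrow> nat \<Rightarrow> nat" where
  "tetration a 0 = 1"
| "tetration a (Suc k) = a ^ tetration a k"

definition MTP :: problem where
  "MTP xs = (case xs of
      [a, k, N] \<Rightarrow> if a > 0 \<and> k > 0 \<and> N > 0 then Some (tetration a k mod N) else None
    | _ \<Rightarrow> None)"

definition sqf_part :: "nat \<Rightarrow> nat" where
  "sqf_part N = (LEAST r. r dvd N \<and> (\<exists>m. N div r = m ^ 2))"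

definition SDP :: problem where
  "SDP xs = (case xs of
      [N] \<Rightarrow> if N > 0 then Some (sqf_part N) else None
    | _ \<Rightarrow> None)"

lemma sqf_part_eq_squarefree_part:
  assumes "N > 0"
  shows "sqf_part N = squarefree_part N"
  unfolding sqf_part_def
proof (rule Least_equality)
  let ?s = "square_part N"
  have s: "?s > 0" "?s ^ 2 dvd N"
    using assms by (auto intro: gr0I)
  have eq: "squarefree_part N = N div ?s ^ 2"
    using assms by (simp add: squarefree_part_def)
  have N: "N = squarefree_part N * ?s ^ 2"
    using s eq by simp
  have pos: "squarefree_part N > 0"
    using N assms by (metis gr0I mult_0 less_irrefl)
  have "N div squarefree_part N = ?s ^ 2"
    using N pos by (metis nonzero_mult_div_cancel_left less_irrefl)
  then show "squarefree_part N dvd N \<and> (\<exists>m. N div squarefree_part N = m ^ 2)"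
    using N by (metis dvd_triv_left)
  fix r assume "r dvd N \<and> (\<exists>m. N div r = m ^ 2)"
  then obtain m where m: "N = r * m ^ 2"
    by (metis dvd_mult_div_cancel)
  then have "m dvd ?s"
    by (simp add: dvd_square_part_iff)
  then have "m ^ 2 \<le> ?s ^ 2"
    using s(1) by (simp add: dvd_imp_le power_mono)
  then have "squarefree_part N * m ^ 2 \<le> r * m ^ 2"
    using N m by (metis mult_le_mono2)
  moreover have "m ^ 2 > 0"
    using m assms by (auto intro: gr0I)
  ultimately show "squarefree_part N \<le> r"
    by simp
qed


subsection \<open>Oracle register programs with bit costs\<close>

text \<open>
  The model of computation is that of the random access machine with logarithmic cost and
  the four arithmetic instructions (Aho, Hopcroft, Ullman, "The Design and Analysis of
  Computer Algorithms", Chapter 1), restricted to direct addressing and structured control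
  flow, and extended by an oracle instruction. Registers hold natural numbers; every
  instruction is charged the bit operations it takes on binary representations:
  linear for loading, adding, subtracting and testing, and the schoolbook bound, the
  product of the lengths, for multiplication and division with remainder. The bit length of
  a result never exceeds the cost of producing it, so polynomial time here agrees with
  polynomial time on Turing machines.
\<close>

abbreviation bit_length :: "nat \<Rightarrow> nat" where
  "bit_length n \<equiv> floorlog 2 n"

definition bit_size :: "nat list \<Rightarrow> nat" where
  "bit_size xs = (\<Sum>x\<leftarrow>xs. bit_length x)"

type_synonym reg = nat
type_synonym state = "reg \<Rightarrow> nat"

datatype arith = Plus | Minus | Times | Quot | Rem

fun arith_val :: "arith \<Rightarrow> nat \<Rightarrow> nat \<Rightarrow> nat" where
  "arith_val Plus m n = m + n"
| "arith_val Minus m n = m - n"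
| "arith_val Times m n = m * n"
| "arith_val Quot m n = m div n"
| "arith_val Rem m n = m mod n"

fun arith_cost :: "arith \<Rightarrow> nat \<Rightarrow> nat \<Rightarrow> nat" where
  "arith_cost Plus m n = 1 + bit_length m + bit_length n"
| "arith_cost Minus m n = 1 + bit_length m + bit_length n"
| "arith_cost _ m n = (1 + bit_length m) * (1 + bit_length n)"

datatype com =
    Skip
  | Load reg nat
  | Arith arith reg reg reg
  | Query reg "reg list"
  | Seq com com
  | Branch reg com com
  | Loop reg com

text \<open>
  \<open>exec f c s t T qs\<close>: with oracle \<open>f\<close>, the program \<open>c\<close> started in state \<open>s\<close> halts in
  state \<open>t\<close> after \<open>T\<close> bit operations, having asked the oracle the queries \<open>qs\<close>, in this order.
  \<open>Branch\<close> and \<open>Loop\<close> test whether a register is nonzero. A query is charged for writing the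
  question and reading the answer, but not for the work of the oracle.
\<close>

inductive exec ::
  "(nat list \<Rightarrow> nat) \<Rightarrow> com \<Rightarrow> state \<Rightarrow> state \<Rightarrow> nat \<Rightarrow> nat list list \<Rightarrow> bool"
  for f where
  Skip: "exec f Skip s s 1 []"
| Load: "exec f (Load x n) s (s(x := n)) (1 + bit_length n) []"
| Arith: "exec f (Arith b x y z) s (s(x := arith_val b (s y) (s z)))
    (arith_cost b (s y) (s z)) []"
| Query: "q = map s ys \<Longrightarrow>
    exec f (Query x ys) s (s(x := f q)) (1 + bit_size q + bit_length (f q)) [q]"
| Seq: "exec f c s t T qs \<Longrightarrow> exec f d t u U rs \<Longrightarrow>
    exec f (Seq c d) s u (T + U) (qs @ rs)"
| Branch_nonzero: "s x \<noteq> 0 \<Longrightarrow> exec f c s t T qs \<Longrightarrow>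
    exec f (Branch x c d) s t (1 + bit_length (s x) + T) qs"
| Branch_zero: "s x = 0 \<Longrightarrow> exec f d s t T qs \<Longrightarrow>
    exec f (Branch x c d) s t (1 + T) qs"
| Loop_nonzero: "s x \<noteq> 0 \<Longrightarrow> exec f c s t T qs \<Longrightarrow> exec f (Loop x c) t u U rs \<Longrightarrow>
    exec f (Loop x c) s u (1 + bit_length (s x) + T + U) (qs @ rs)"
| Loop_zero: "s x = 0 \<Longrightarrow> exec f (Loop x c) s s 1 []"

inductive_cases exec_SkipE: "exec f Skip s t T qs"
  and exec_LoadE: "exec f (Load x n) s t T qs"
  and exec_ArithE: "exec f (Arith b x y z) s t T qs"
  and exec_QueryE: "exec f (Query x ys) s t T qs"
  and exec_SeqE: "exec f (Seq c d) s t T qs"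
  and exec_BranchE: "exec f (Branch x c d) s t T qs"
  and exec_LoopE: "exec f (Loop x c) s t T qs"

lemma exec_deterministic:
  assumes "exec f c s t T qs" and "exec f c s t' T' qs'"
  shows "t' = t \<and> T' = T \<and> qs' = qs"
  using assms
proof (induction arbitrary: t' T' qs' rule: exec.induct)
  case (Seq c s t T qs d u U rs)
  from Seq.prems show ?case
    by (rule exec_SeqE) (metis Seq.IH)
next
  case (Branch_nonzero s x c t T qs d)
  from Branch_nonzero.prems show ?case
    by (rule exec_BranchE) (use Branch_nonzero.hyps in \<open>auto dest!: Branch_nonzero.IH\<close>)
next
  case (Branch_zero s x d t T qs c)
  from Branch_zero.prems show ?case
    by (rule exec_BranchE) (use Branch_zero.hyps in \<open>auto dest!: Branch_zero.IH\<close>)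
next
  case (Loop_nonzero s x c t T qs u U rs)
  from Loop_nonzero.prems show ?case
    by (rule exec_LoopE) (use Loop_nonzero.hyps in \<open>auto dest!: Loop_nonzero.IH(1) dest: Loop_nonzero.IH(2)\<close>)
next
  case (Loop_zero s x c)
  from Loop_zero.prems show ?case
    by (rule exec_LoopE) (use Loop_zero.hyps in auto)
qed (auto elim: exec_SkipE exec_LoadE exec_ArithE exec_QueryE)


subsection \<open>Deterministic polynomial-time reducibility\<close>

definition solves :: "(nat list \<Rightarrow> nat) \<Rightarrow> problem \<Rightarrow> bool" where
  "solves f Q \<longleftrightarrow> (\<forall>xs y. Q xs = Some y \<longrightarrow> f xs = y)"

text \<open>The input is placed in the first registers; all other registers start at 0.\<close>

definition input_state :: "nat list \<Rightarrow> state" where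
  "input_state xs = (\<lambda>i. if i < length xs then xs ! i else 0)"

text \<open>
  The program and the polynomial are chosen before the oracle, and nothing is assumed about
  the answers of the oracle to queries that are not instances of \<open>Q\<close>. The output is read
  off register 0.
\<close>

definition poly_time_reducible :: "problem \<Rightarrow> problem \<Rightarrow> bool" where
  "poly_time_reducible P Q \<longleftrightarrow>
    (\<exists>(c :: com) (p :: nat poly). \<forall>f. solves f Q \<longrightarrow>
      (\<forall>xs y. P xs = Some y \<longrightarrow>
        (\<exists>t T qs. exec f c (input_state xs) t T qs \<and> t 0 = y \<and>
          T \<le> poly p (bit_size xs) \<and>
          length qs \<le> poly p (bit_size xs) \<and>
          (\<forall>q \<in> set qs. bit_size q \<le> poly p (bit_size xs)))))"

end

theory Submission
  imports Defs "HOL-Number_Theory.Number_Theory"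
begin

text \<open>
  Write \<open>T\<^sub>k\<close> for the tower of height \<open>k\<close> over \<open>a\<close>. The oracle gives \<open>d = T\<^sub>k\<^sub>+\<^sub>1 - T\<^sub>k\<close> modulo \<open>N\<close>.
  If \<open>M\<close> divides \<open>N\<close> and \<open>g = gcd(M, d)\<close>, then the square of \<open>h = gcd(g, M/g)\<close> divides \<open>M\<close>, and
  \<open>p\<close> divides \<open>h\<close> whenever \<open>p\<^sup>2\<close> divides \<open>M\<close> and \<open>p\<close> divides \<open>d\<close> exactly once. Replacing \<open>M\<close> by
  \<open>M/h\<^sup>2\<close> again and again, starting with \<open>M = N\<close>, therefore leads to the squarefree part, provided
  that for every prime \<open>p\<close> some small \<open>a\<close> and \<open>k\<close> make \<open>p\<close> divide \<open>d\<close> exactly once.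

  For small \<open>p\<close> take \<open>a = p\<close> and \<open>k = 1\<close>. For large \<open>p\<close> take a small \<open>a\<close> with
  \<open>a\<^sup>p\<^sup>-\<^sup>1 \<noteq> 1\<close> modulo \<open>p\<^sup>2\<close>, and the least \<open>k\<close> such that \<open>p\<close> divides \<open>T\<^sub>k\<^sub>+\<^sub>1 - T\<^sub>k\<close>. Such a \<open>k\<close> is
  logarithmic in \<open>p\<close>, since towers become constant modulo \<open>m\<close> as fast as the iterated totients of
  \<open>m\<close> reach 1. As \<open>p\<close> does not divide \<open>n = T\<^sub>k - T\<^sub>k\<^sub>-\<^sub>1\<close>, the congruence \<open>a\<^sup>n = 1\<close> modulo \<open>p\<^sup>2\<close> would force
  \<open>a\<^sup>p\<^sup>-\<^sup>1 = 1\<close> modulo \<open>p\<^sup>2\<close>; so \<open>p\<close> divides \<open>T\<^sub>k\<^sub>+\<^sub>1 - T\<^sub>k\<close> exactly once.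

  A small \<open>a\<close> exists by counting: the solutions of \<open>x\<^sup>p\<^sup>-\<^sup>1 = 1\<close> modulo \<open>p\<^sup>2\<close> form a group of order \<open>p - 1\<close>,
  but if all small primes were solutions, their products below \<open>p\<^sup>2\<close> would be too many, by
  Chebyshev's lower bound for the number of primes.
\<close>

subsection \<open>Chebyshev's lower bound\<close>

text \<open>The fractions are the entries 1/((n+1) (n choose j)) of the Leibniz harmonic triangle.
  Its first column consists of the 1/(n+1), and every later entry is a difference of two entries of
  the column before, so multiplying by \<open>c\<close> clears all denominators.\<close>

lemma leibniz_triangle_Ints:
  fixes c :: nat
  assumes "\<And>i. 0 < i \<Longrightarrow> i \<le> Suc n \<Longrightarrow> i dvd c" and "j \<le> n"
  shows "real c * (fact j * fact (n - j) / fact (Suc n)) \<in> \<int>"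
  using assms
proof (induction j arbitrary: n)
  case 0
  then have "Suc n dvd c" by simp
  then obtain e where "c = Suc n * e" ..
  then have "real c = real (Suc n) * real e" by (simp only: of_nat_mult)
  then have "real c * (fact 0 * fact (n - 0) / fact (Suc n)) = real e"
    by (simp del: of_nat_Suc)
  then show ?case by (metis Ints_of_nat)
next
  case (Suc j)
  then obtain r where r: "n = Suc (j + r)"
    by (metis add_Suc le_Suc_ex)
  have 1: "real c * (fact j * fact r / fact (Suc (j + r))) \<in> \<int>"
    using Suc.IH[of "j + r"] Suc.prems(1) r by simp
  have 2: "real c * (fact j * fact (Suc r) / fact (Suc n)) \<in> \<int>"
    using Suc.IH[of n] Suc.prems r by (simp add: Suc_diff_le del: fact_Suc)
  have "fact (Suc j) * fact r / fact (Suc n) =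
      fact j * fact r / fact (Suc (j + r)) - fact j * fact (Suc r) / (fact (Suc n) :: real)"
  proof -
    have f: "fact (Suc n) = real (Suc n) * fact (Suc (j + r))" by (simp add: r)
    have "fact j * fact r / fact (Suc (j + r)) = real (Suc n) * (fact j * fact r) / (fact (Suc n) :: real)"
      unfolding f by (simp del: fact_Suc)
    then show ?thesis
      by (simp add: r diff_divide_distrib [symmetric] del: fact_Suc) (simp add: algebra_simps)
  qed
  then have "real c * (fact (Suc j) * fact (n - Suc j) / fact (Suc n)) =
      real c * (fact j * fact r / fact (Suc (j + r))) - real c * (fact j * fact (Suc r) / fact (Suc n))"
    using r by (simp add: right_diff_distrib del: fact_Suc)
  then show ?case using 1 2 by simp
qed

lemma Suc_times_binomial_dvd_Lcm:
  assumes "j \<le> n"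
  shows "Suc n * (n choose j) dvd Lcm {1..Suc n}"
proof -
  let ?c = "Lcm {1..Suc n}"
  have "real ?c * (fact j * fact (n - j) / fact (Suc n)) \<in> \<int>"
    by (rule leibniz_triangle_Ints) (use assms in auto)
  moreover have "fact j * fact (n - j) / fact (Suc n) = 1 / real (Suc n * (n choose j))"
    using assms by (simp add: binomial_fact field_simps)
  ultimately have "real ?c / real (Suc n * (n choose j)) \<in> \<int>"
    by (metis mult.right_neutral times_divide_eq_right)
  then obtain e where e: "real ?c / real (Suc n * (n choose j)) = of_int e"
    by (auto elim: Ints_cases)
  have "Suc n * (n choose j) > 0" using assms by simp
  then have "real ?c = of_int e * real (Suc n * (n choose j))"
    using e by (metis nonzero_divide_eq_eq of_nat_0_less_iff less_irrefl)
  then have "int ?c = e * int (Suc n * (n choose j))"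
    by (metis of_int_eq_iff of_int_mult of_int_of_nat_eq)
  then have "int (Suc n * (n choose j)) dvd int ?c" by simp
  then show ?thesis by (metis of_nat_dvd_iff)
qed

lemma Lcm_atLeastAtMost_pos: "Lcm {1..m::nat} > 0"
  by (induction m) (auto simp: atLeastAtMostSuc_conv intro: lcm_pos_nat)

text \<open>The row sum \<open>2 ^ n\<close> has n+1 summands, none above the central binomial
  coefficient, and n+1 times that coefficient divides the lcm.\<close>

lemma two_power_le_Lcm: "2 ^ n \<le> Lcm {1..Suc n}"
proof -
  have "2 ^ n = (\<Sum>k\<le>n. n choose k)" by (simp add: choose_row_sum)
  also have "\<dots> \<le> (\<Sum>k\<le>n. n choose (n div 2))"
    by (intro sum_mono binomial_maximum)
  also have "\<dots> = Suc n * (n choose (n div 2))" by simp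
  also have "\<dots> \<le> Lcm {1..Suc n}"
    by (rule dvd_imp_le[OF Suc_times_binomial_dvd_Lcm Lcm_atLeastAtMost_pos]) simp
  finally show ?thesis .
qed

lemma prime_power_multiplicity_Lcm_le:
  assumes "prime (p::nat)"  "m > 0"
  shows "p ^ multiplicity p (Lcm {1..m}) \<le> m"
  using assms(2)
proof (induction m)
  case (Suc m)
  show ?case
  proof (cases "m = 0")
    case False
    have "Lcm {1..Suc m} = lcm (Suc m) (Lcm {1..m})"
      by (simp add: atLeastAtMostSuc_conv)
    then have "multiplicity p (Lcm {1..Suc m}) =
        max (multiplicity p (Suc m)) (multiplicity p (Lcm {1..m}))"
      using assms(1) Lcm_atLeastAtMost_pos[of m]
      by (metis multiplicity_lcm nat.simps(3) less_irrefl prime_imp_prime_elem)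
    moreover have "p ^ multiplicity p (Suc m) \<le> Suc m"
      by (intro dvd_imp_le multiplicity_dvd) simp
    moreover have "p ^ multiplicity p (Lcm {1..m}) \<le> Suc m"
      using Suc False by simp
    ultimately show ?thesis by (auto simp: max_def)
  qed simp
qed simp

text \<open>Only primes up to \<open>m\<close> divide the lcm, and each contributes a prime power
  that is at most \<open>m\<close>.\<close>

lemma Lcm_le_power_card_primes:
  assumes "m > 0"
  shows "Lcm {1..m} \<le> m ^ card {p::nat. prime p \<and> p \<le> m}"
proof -
  let ?c = "Lcm {1..m}"
  have pos: "?c > 0" by (rule Lcm_atLeastAtMost_pos)
  have le: "p ^ multiplicity p ?c \<le> m" if "prime p" for p
    using prime_power_multiplicity_Lcm_le that assms by simp
  have sub: "prime_factors ?c \<subseteq> {p. prime p \<and> p \<le> m}"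
  proof
    fix p assume p: "p \<in> prime_factors ?c"
    then have "multiplicity p ?c > 0"
      by (simp add: prime_factors_multiplicity)
    then have "p \<le> p ^ multiplicity p ?c"
      using in_prime_factors_imp_prime[OF p] by (intro self_le_power prime_ge_1_nat)
    then show "p \<in> {p. prime p \<and> p \<le> m}"
      using p le in_prime_factors_imp_prime by (auto intro: order_trans)
  qed
  have "?c = (\<Prod>p\<in>prime_factors ?c. p ^ multiplicity p ?c)"
    using pos by (simp add: prod_prime_factors)
  also have "\<dots> \<le> (\<Prod>p\<in>prime_factors ?c. m)"
    by (intro prod_mono conjI le in_prime_factors_imp_prime) auto
  also have "\<dots> = m ^ card (prime_factors ?c)" by simp
  also have "\<dots> \<le> m ^ card {p. prime p \<and> p \<le> m}"
    using assms sub by (intro power_increasing card_mono) auto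
  finally show ?thesis .
qed

lemma card_primes_lower_bound:
  assumes "Suc n \<le> 2 ^ t"
  shows "n \<le> t * card {p::nat. prime p \<and> p \<le> Suc n}"
proof -
  let ?c = "card {p::nat. prime p \<and> p \<le> Suc n}"
  have "2 ^ n \<le> Suc n ^ ?c"
    using two_power_le_Lcm Lcm_le_power_card_primes order_trans zero_less_Suc by blast
  also have "\<dots> \<le> (2 ^ t) ^ ?c" using assms by (rule power_mono) simp
  also have "\<dots> = 2 ^ (t * ?c)" by (simp add: power_mult)
  finally show ?thesis by simp
qed

subsection \<open>Small bases with nonzero Fermat quotient\<close>

text \<open>In the binomial expansion of (b + pc)^p the linear term gains a second factor p from its
  coefficient, and the higher terms contain (pc)^2.\<close>

lemma cong_power_prime_lift:
  fixes x y p :: nat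
  assumes "[x = y] (mod p)"
  shows "[x ^ p = y ^ p] (mod p ^ 2)"
proof -
  have *: "[(b + p * c) ^ p = b ^ p] (mod p ^ 2)" for b c :: nat
  proof (cases "p \<ge> 2")
    case True
    have "(b + p * c) ^ p = (\<Sum>k\<le>p. (p choose k) * (p * c) ^ k * b ^ (p - k))"
      by (subst add.commute) (simp add: binomial_ring)
    also have "[\<dots> = (\<Sum>k\<le>p. if k = 0 then b ^ p else 0)] (mod p ^ 2)"
    proof (rule cong_sum)
      fix k
      have "p ^ 2 dvd (p choose k) * (p * c) ^ k * b ^ (p - k)" if "k \<noteq> 0"
      proof (cases "k = 1")
        case True
        then have "(p choose k) * (p * c) ^ k * b ^ (p - k) = p ^ 2 * (c * b ^ (p - k))"
          by (simp add: power2_eq_square)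
        then show ?thesis by (metis dvd_triv_left)
      next
        case False
        then have "2 \<le> k" using that by simp
        then have "p ^ 2 dvd (p * c) ^ k"
          by (simp add: power_mult_distrib le_imp_power_dvd)
        then show ?thesis by simp
      qed
      then show "[(p choose k) * (p * c) ^ k * b ^ (p - k) = (if k = 0 then b ^ p else 0)] (mod p ^ 2)"
        by (simp add: cong_0_iff)
    qed
    finally show ?thesis by simp
  next
    case False
    then have "p = 0 \<or> p = 1" by auto
    then show ?thesis by auto
  qed
  have "x \<le> y \<or> y \<le> x" by auto
  then show ?thesis
  proof
    assume "x \<le> y"
    then have "\<exists>q. y = q * p + x"
      using assms by (metis cong_le_nat cong_sym)
    then obtain q where "y = x + p * q" by (metis add.commute mult.commute)
    then show ?thesis using *[of x q] by (simp add: cong_sym)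
  next
    assume "y \<le> x"
    then have "\<exists>q. x = q * p + y"
      using assms by (simp add: cong_le_nat)
    then obtain q where "x = y + p * q" by (metis add.commute mult.commute)
    then show ?thesis using *[of y q] by simp
  qed
qed

text \<open>A solution satisfies x^p = x modulo p^2, and x^p modulo p^2 depends only on x modulo p.
  So the elements of \<open>S\<close> have distinct nonzero residues modulo p.\<close>

lemma card_fermat_residues_less:
  fixes p :: nat
  assumes "prime p"
    and S: "\<And>x. x \<in> S \<Longrightarrow> x < p ^ 2 \<and> [x ^ (p - 1) = 1] (mod p ^ 2)"
  shows "card S < p"
proof -
  have p: "p \<ge> 2" using assms(1) by (rule prime_ge_2_nat)
  have fix_p: "[x ^ p = x] (mod p ^ 2)" if "x \<in> S" for x
  proof -
    have "[x * x ^ (p - 1) = x * 1] (mod p ^ 2)"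
      using S[OF that] by (intro cong_mult) auto
    then show ?thesis using p by (simp add: power_eq_if)
  qed
  have "inj_on (\<lambda>x. x mod p) S"
  proof (rule inj_onI)
    fix x y assume xy: "x \<in> S" "y \<in> S" "x mod p = y mod p"
    then have "[x ^ p = y ^ p] (mod p ^ 2)"
      by (intro cong_power_prime_lift) (simp add: cong_def)
    then have "[x = y] (mod p ^ 2)"
      using fix_p xy by (metis cong_sym cong_trans)
    then show "x = y" using S xy by (meson cong_less_modulus_unique_nat)
  qed
  moreover have "(\<lambda>x. x mod p) ` S \<subseteq> {0<..<p}"
  proof
    fix r assume "r \<in> (\<lambda>x. x mod p) ` S"
    then obtain x where x: "x \<in> S" "r = x mod p" by blast
    have "\<not> p dvd x"
    proof
      assume "p dvd x"
      then have "p dvd x ^ (p - 1)" using p by (simp add: dvd_power_le dvd_trans dvd_power)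
      moreover have "[x ^ (p - 1) = 1] (mod p)"
        using S[OF x(1)] by (metis cong_dvd_modulus_nat dvd_power zero_less_numeral)
      ultimately have "p dvd 1" by (metis cong_dvd_iff)
      then show False using p by simp
    qed
    then show "r \<in> {0<..<p}" using x p by (simp add: dvd_eq_mod_eq_0)
  qed
  ultimately have "card S \<le> card {0<..<p}" by (metis card_inj_on_le finite_greaterThanLessThan)
  then show ?thesis using p by simp
qed

lemma inj_on_prod_primes:
  "inj_on (\<lambda>B. \<Prod>B) {B. finite B \<and> (\<forall>q\<in>B. prime (q::nat))}"
proof (rule inj_onI)
  fix A B :: "nat set"
  assume A: "A \<in> {B. finite B \<and> (\<forall>q\<in>B. prime q)}" and B: "B \<in> {B. finite B \<and> (\<forall>q\<in>B. prime q)}"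
    and eq: "\<Prod>A = \<Prod>B"
  have *: "{q. prime q \<and> q dvd \<Prod>C} = C" if C: "finite C" "\<forall>q\<in>C. prime q" for C :: "nat set"
  proof (intro equalityI subsetI)
    fix q assume "q \<in> {q. prime q \<and> q dvd \<Prod>C}"
    then have q: "prime q" "q dvd \<Prod>C" by auto
    then obtain r where "r \<in> C" "q dvd r" using prime_dvd_prod_iff[of C q "\<lambda>x. x"] C by auto
    then show "q \<in> C" using C q primes_dvd_imp_eq by blast
  qed (use C in \<open>auto intro: dvd_prodI\<close>)
  have "A = {q. prime q \<and> q dvd \<Prod>A}" by (rule *[symmetric]) (use A in auto)
  also have "\<dots> = {q. prime q \<and> q dvd \<Prod>B}" by (simp only: eq)
  also have "\<dots> = B" by (rule *) (use B in auto)
  finally show "A = B" .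
qed

text \<open>\<open>t\<close> and \<open>L\<close> bound the binary logarithms of
  \<open>z ^ 4\<close> and \<open>p\<close>. If all primes up to \<open>z ^ 4\<close> were
  solutions, so would be the products of \<open>u\<close> of them, where \<open>u\<close> is the
  largest exponent with z^(2u) \<le> p. These products stay below p^2, yet there are more than p of
  them.\<close>

lemma exists_small_nonfermat_base:
  fixes p z t :: nat
  assumes p: "prime p" and z: "1 < z" "z ^ 4 < p" "z ^ 4 \<le> 2 ^ t"
    and L: "p \<le> 2 ^ L" "t * L < z"
  shows "\<exists>a \<le> z ^ 4. 2 \<le> a \<and> \<not> [a ^ (p - 1) = 1] (mod p ^ 2)"
proof (rule ccontr)
  assume neg: "\<not> ?thesis"
  let ?P = "{q::nat. prime q \<and> q \<le> z ^ 4}"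
  let ?\<pi> = "card ?P"
  have finP: "finite ?P" by (rule finite_subset[of _ "{..z ^ 4}"]) auto
  have p2: "p \<ge> 2" using p by (rule prime_ge_2_nat)
  have z2: "1 < z ^ 2" using z(1) by (intro one_less_power) auto
  obtain u where u: "(z ^ 2) ^ u \<le> p" "p < (z ^ 2) ^ Suc u"
    using ex_power_ivl1[of "z ^ 2" p] z2 p2 by auto
  \<comment> \<open>This gives 2(u+1) \<le> 3u, so that z^(3u) exceeds p.\<close>
  have u2: "u \<ge> 2"
  proof (rule ccontr)
    assume "\<not> u \<ge> 2"
    then have "Suc u \<le> 2" by simp
    then have "(z ^ 2) ^ Suc u \<le> (z ^ 2) ^ 2" using z2 by (intro power_increasing) auto
    then show False using u(2) z(2) by simp
  qed
  have "2 ^ u \<le> (z ^ 2) ^ u" using z2 by (intro power_mono) auto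
  then have "(2::nat) ^ u \<le> 2 ^ L" using u(1) L(1) by linarith
  then have uL: "u \<le> L" by simp
  \<comment> \<open>Chebyshev's bound gives \<open>t * ?\<pi>\<close> \<ge> z^4 - 1, which is at
    least \<open>t * L * z ^ 3\<close> because tL + 1 \<le> z.\<close>
  have "u * z ^ 3 \<le> ?\<pi>"
  proof -
    obtain n where n: "z ^ 4 = Suc n" using z(1) by (metis gr0_implies_Suc zero_less_power less_trans zero_less_one)
    have "n \<le> t * ?\<pi>" using card_primes_lower_bound[of n t] z(3) n by simp
    moreover have "t * L * z ^ 3 \<le> n"
    proof -
      have "(t * L + 1) * z ^ 3 \<le> z * z ^ 3" using L(2) by (intro mult_right_mono) auto
      also have "\<dots> = Suc n" using n by (simp add: power_eq_if)
      finally have "t * L * z ^ 3 + z ^ 3 \<le> Suc n" by (simp add: algebra_simps)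
      moreover have "z ^ 3 \<ge> 1" using z(1) by simp
      ultimately show ?thesis by linarith
    qed
    ultimately have "t * (L * z ^ 3) \<le> t * ?\<pi>" by (metis mult.assoc order_trans)
    moreover have "t > 0" using z(3) one_less_power[OF z(1), of 4] by (cases t) auto
    ultimately have "L * z ^ 3 \<le> ?\<pi>" by simp
    moreover have "u * z ^ 3 \<le> L * z ^ 3" using uL by simp
    ultimately show ?thesis by linarith
  qed
  note bound = this
  have z3: "1 \<le> z ^ 3" using z(1) by simp
  have u_le: "u \<le> ?\<pi>" using bound z3 by (metis le_trans mult.right_neutral mult_le_mono2)
  have "z ^ (3 * u) \<le> ?\<pi> choose u"
  proof -
    have "real (u * z ^ 3) \<le> real ?\<pi>" using bound by (simp only: of_nat_le_iff)
    then have "real (z ^ 3) \<le> real ?\<pi> / real u" using u2 by (simp add: field_simps)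
    then have "real (z ^ 3) ^ u \<le> (real ?\<pi> / real u) ^ u" by (intro power_mono) auto
    also have "\<dots> \<le> real (?\<pi> choose u)" by (rule binomial_ge_n_over_k_pow_k) (fact u_le)
    finally have "real ((z ^ 3) ^ u) \<le> real (?\<pi> choose u)" by simp
    then show ?thesis by (simp only: of_nat_le_iff power_mult)
  qed
  moreover have "p < z ^ (3 * u)"
  proof -
    have "p < z ^ (2 * Suc u)" using u(2) by (simp only: power_mult)
    also have "\<dots> \<le> z ^ (3 * u)" using z(1) u2 by (intro power_increasing) auto
    finally show ?thesis .
  qed
  moreover have "?\<pi> choose u < p"
  proof -
    let ?F = "{B. B \<subseteq> ?P \<and> card B = u}"
    have fin: "finite B" if "B \<in> ?F" for B using that finP finite_subset by blast
    have "card ((\<lambda>B. \<Prod>B) ` ?F) < p"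
    proof (rule card_fermat_residues_less[OF p])
      fix x assume "x \<in> (\<lambda>B. \<Prod>B) ` ?F"
      then obtain B where B: "B \<in> ?F" "x = \<Prod>B" by blast
      have "x \<le> (\<Prod>b\<in>B. z ^ 4)" unfolding B(2) using B(1) by (intro prod_mono) auto
      also have "\<dots> = ((z ^ 2) ^ u) ^ 2" using B(1) by (simp add: power_mult [symmetric] mult.commute)
      also have "\<dots> \<le> p ^ 2" using u(1) by (rule power_mono) simp
      finally have le: "x \<le> p ^ 2" .
      have "[x ^ (p - 1) = 1] (mod p ^ 2)"
      proof -
        have "[(\<Prod>b\<in>B. b ^ (p - 1)) = (\<Prod>b\<in>B. 1)] (mod p ^ 2)"
        proof (rule cong_prod)
          fix b assume "b \<in> B"
          then have "prime b" "b \<le> z ^ 4" using B(1) by auto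
          then show "[b ^ (p - 1) = 1] (mod p ^ 2)" using neg prime_ge_2_nat by blast
        qed
        then show ?thesis by (simp add: B(2) prod_power_distrib)
      qed
      moreover have "x \<noteq> p ^ 2"
      proof
        assume "x = p ^ 2"
        then have "[0 = 1] (mod p ^ 2)"
          using \<open>[x ^ (p - 1) = 1] (mod p ^ 2)\<close> p2
          by (metis cong_0_iff cong_sym cong_trans dvd_power zero_less_diff less_le_trans one_less_numeral_iff semiring_norm(76))
        then show False using p2 by (simp only: cong_0_1_nat power_eq_1_iff) simp
      qed
      ultimately show "x < p ^ 2 \<and> [x ^ (p - 1) = 1] (mod p ^ 2)" using le by simp
    qed
    moreover have "card ((\<lambda>B. \<Prod>B) ` ?F) = card ?F"
      by (rule card_image, rule inj_on_subset[OF inj_on_prod_primes]) (use fin in auto)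
    moreover have "card ?F = ?\<pi> choose u" using finP by (rule n_subsets)
    ultimately show ?thesis by simp
  qed
  ultimately show False by linarith
qed

subsection \<open>Stabilisation of towers\<close>

text \<open>Euler's theorem without coprimality: every prime dividing \<open>a\<close> has exponent
  below \<open>B\<close> in \<open>m\<close>, so gcd(m, a^B) absorbs its full power and
  \<open>a\<close> is coprime to the cofactor \<open>m1\<close>. Euler's theorem modulo
  \<open>m1\<close> is then multiplied by a^B.\<close>

lemma power_add_totient_cong:
  fixes a m B :: nat
  assumes "m < 2 ^ B"
  shows "[a ^ (B + totient m) = a ^ B] (mod m)"
proof (cases "m = 0")
  case False
  define m2 where "m2 = gcd m (a ^ B)"
  define m1 where "m1 = m div m2"
  have m: "m = m2 * m1" by (simp add: m1_def m2_def)
  have "coprime a m1"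
  proof (rule ccontr)
    assume "\<not> coprime a m1"
    then have "gcd a m1 \<noteq> 1" using coprime_iff_gcd_eq_1 by blast
    then obtain q where q: "prime q" "q dvd a" "q dvd m1"
      using prime_factor_nat[of "gcd a m1"] by auto
    let ?e = "multiplicity q m"
    show False
    proof (cases "B \<le> ?e")
      case True
      then have "q ^ B dvd m" by (simp add: multiplicity_dvd')
      then have "q ^ B \<le> m" using False by (simp add: dvd_imp_le)
      moreover have "2 ^ B \<le> q ^ B" using q(1) prime_ge_2_nat by (intro power_mono) auto
      ultimately show False using assms by linarith
    next
      case nB: False
      have "q ^ ?e dvd q ^ B" using nB by (simp add: le_imp_power_dvd)
      also have "q ^ B dvd a ^ B" using q(2) by (rule dvd_power_same)
      finally have "q ^ ?e dvd m2" by (simp add: m2_def multiplicity_dvd)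
      then have "q ^ ?e * q dvd m2 * m1" using q(3) by (rule mult_dvd_mono)
      then have "q ^ Suc ?e dvd m" using m by (simp add: mult.commute)
      then show False
        using q(1) False by (metis power_dvd_iff_le_multiplicity not_less_eq_eq order_refl not_prime_unit)
    qed
  qed
  then have "[a ^ totient m1 = 1] (mod m1)" by (rule euler_theorem)
  moreover have "totient m1 dvd totient m" using m by (intro totient_dvd) simp
  ultimately have e: "[a ^ totient m = 1] (mod m1)"
    by (metis cong_pow dvdE power_mult power_one)
  obtain c where c: "a ^ B = m2 * c" using m2_def by (metis dvdE gcd_dvd2)
  have "[c * a ^ totient m = c * 1] (mod m1)" using e by (rule cong_scalar_left)
  then have "[m2 * (c * a ^ totient m) = m2 * (c * 1)] (mod m2 * m1)" by (rule cong_cmult_leftI)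
  then have "[a ^ B * a ^ totient m = a ^ B] (mod m2 * m1)"
    by (simp only: c mult.assoc mult_1_right)
  then show ?thesis by (simp only: power_add m [symmetric])
qed simp

lemma power_cong_totient:
  fixes a m B x y :: nat
  assumes "m < 2 ^ B" "B \<le> x" "x \<le> y" "[x = y] (mod totient m)"
  shows "[a ^ x = a ^ y] (mod m)"
proof -
  obtain q where q: "y = q * totient m + x"
    using assms(3,4) by (metis cong_le_nat cong_sym)
  have "[a ^ (q * totient m + x) = a ^ x] (mod m)" for q
  proof (induction q)
    case (Suc q)
    have x: "a ^ x = a ^ B * a ^ (x - B)" using assms(2) by (simp add: power_add [symmetric])
    have "a ^ (Suc q * totient m + x) =
        a ^ (B + totient m) * (a ^ (x - B) * a ^ (q * totient m))"
      by (simp add: power_add x algebra_simps)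
    also have "[\<dots> = a ^ B * (a ^ (x - B) * a ^ (q * totient m))] (mod m)"
      by (intro cong_scalar_right power_add_totient_cong assms)
    also have "a ^ B * (a ^ (x - B) * a ^ (q * totient m)) = a ^ (q * totient m + x)"
      by (simp add: power_add x algebra_simps)
    also have "[\<dots> = a ^ x] (mod m)" by (rule Suc)
    finally show ?case .
  qed simp
  then show ?thesis using q cong_sym by blast
qed

lemma tetration_less_Suc:
  assumes "2 \<le> a"
  shows "tetration a k < tetration a (Suc k)"
proof -
  have "tetration a k < 2 ^ tetration a k" by (rule less_exp)
  also have "\<dots> \<le> a ^ tetration a k" using assms by (intro power_mono) auto
  finally show ?thesis by simp
qed

lemma less_tetration: "2 \<le> a \<Longrightarrow> k < tetration a k"
  by (induction k) (use tetration_less_Suc[of a] in \<open>auto intro: le_less_trans simp: Suc_le_eq\<close>)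

text \<open>Totatives of an even number are odd.\<close>

lemma totient_even_le:
  assumes "even m"
  shows "totient m \<le> m div 2"
proof -
  obtain n where n: "m = 2 * n" using assms by blast
  have "totatives m \<subseteq> (\<lambda>i. 2 * i + 1) ` {..<n}"
  proof
    fix k assume "k \<in> totatives m"
    then have k: "k \<le> m" "coprime k m" by (auto simp: in_totatives_iff)
    then have "odd k" using assms by (metis coprime_common_divisor odd_one)
    then show "k \<in> (\<lambda>i. 2 * i + 1) ` {..<n}" using k n by (auto elim!: oddE)
  qed
  then have "card (totatives m) \<le> card {..<n}"
    by (meson surj_card_le finite_lessThan)
  then show ?thesis using n by (simp add: totient_def)
qed

text \<open>Stability passes from exponents modulo the totient to powers modulo \<open>m\<close>;
  the condition on \<open>k\<close> makes the exponent \<open>tetration a k\<close> at least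
  \<open>B\<close>.\<close>

lemma tetration_stable_step:
  assumes a: "2 \<le> a" and m: "m < 2 ^ B" and B: "B \<le> Suc k"
    and eq: "[tetration a (Suc k) = tetration a k] (mod totient m)"
  shows "[tetration a (Suc (Suc k)) = tetration a (Suc k)] (mod m)"
proof -
  have "[a ^ tetration a k = a ^ tetration a (Suc k)] (mod m)"
  proof (rule power_cong_totient[OF m])
    show "B \<le> tetration a k" using less_tetration[OF a, of k] B by simp
    show "tetration a k \<le> tetration a (Suc k)" using tetration_less_Suc[OF a] less_imp_le by blast
    show "[tetration a k = tetration a (Suc k)] (mod totient m)" using eq by (rule cong_sym)
  qed
  then show ?thesis by (simp add: cong_sym)
qed

lemma tetration_stable:
  assumes a: "2 \<le> a"
  shows "0 < m \<Longrightarrow> m < 2 ^ B \<Longrightarrow> 2 * B \<le> k \<Longrightarrow> [tetration a (Suc k) = tetration a k] (mod m)"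
proof (induction B arbitrary: m k)
  case (Suc B)
  \<comment> \<open>Two applications of the totient halve the modulus: the first makes it even.\<close>
  have even_case: "[tetration a (Suc j) = tetration a j] (mod n)"
    if n: "even n" "0 < n" "n < 2 ^ Suc B" and j: "2 * B + 1 \<le> j" for n j
  proof -
    obtain i where i: "j = Suc i" "2 * B \<le> i" using j by (cases j) auto
    have "[tetration a (Suc i) = tetration a i] (mod totient n)"
    proof (rule Suc.IH)
      show "totient n < 2 ^ B" using totient_even_le[OF n(1)] n(3) by auto
    qed (use n i in auto)
    then have "[tetration a (Suc (Suc i)) = tetration a (Suc i)] (mod n)"
      using i j by (intro tetration_stable_step[OF a n(3)]) auto
    then show ?thesis using i by simp
  qed
  show ?case
  proof (cases "m \<le> 2")
    \<comment> \<open>The totient of 2 is odd, but 2 is itself even, so \<open>even_case\<close>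
      applies to it directly.\<close>
    case True
    then have "m = 1 \<or> even m" using Suc.prems(1) by (auto simp: numeral_2_eq_2 le_Suc_eq)
    then show ?thesis
    proof
      assume "even m"
      then show ?thesis using Suc.prems by (intro even_case) auto
    qed simp
  next
    case False
    obtain j where j: "k = Suc j" "2 * B + 1 \<le> j" using Suc.prems(3) by (cases k) auto
    have "[tetration a (Suc j) = tetration a j] (mod totient m)"
    proof (rule even_case)
      show "even (totient m)" using False by (intro totient_even) auto
      show "totient m < 2 ^ Suc B" using totient_le[of m] Suc.prems(2) by linarith
    qed (use j False in auto)
    then have "[tetration a (Suc (Suc j)) = tetration a (Suc j)] (mod m)"
      using j by (intro tetration_stable_step[OF a Suc.prems(2)]) auto
    then show ?thesis using j by simp
  qed
qed simp

subsection \<open>Towers separating a prime from its square\<close>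

definition tower_separates :: "nat \<Rightarrow> nat \<Rightarrow> nat \<Rightarrow> bool" where
  "tower_separates p a k \<longleftrightarrow>
     [tetration a (Suc k) = tetration a k] (mod p) \<and>
     \<not> [tetration a (Suc k) = tetration a k] (mod p ^ 2)"

lemma tower_separates_nonfermat_base:
  assumes p: "prime p" "p < 2 ^ B" and a: "2 \<le> a" "a < p" "\<not> [a ^ (p - 1) = 1] (mod p ^ 2)"
  shows "\<exists>k. 0 < k \<and> k \<le> 2 * B \<and> tower_separates p a k"
proof -
  let ?E = "\<lambda>k. [tetration a (Suc k) = tetration a k] (mod p)"
  have p0: "0 < p" using p(1) by (rule prime_gt_0_nat)
  have ex: "?E (2 * B)" by (rule tetration_stable[OF a(1) p0 p(2)]) simp
  define k where "k = (LEAST k. ?E k)"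
  have k: "?E k" "k \<le> 2 * B" unfolding k_def using ex by (auto intro: LeastI Least_le)
  \<comment> \<open>The first difference is a - 1, strictly between 0 and p. Hence the least
    \<open>k\<close> has a predecessor \<open>j\<close>, at which p does not divide the
    difference.\<close>
  have "\<not> ?E 0" using a by (auto simp: cong_def)
  then obtain j where j: "k = Suc j" using k(1) by (cases k) auto
  then have nE: "\<not> ?E j" unfolding k_def using not_less_Least[of j ?E] by simp
  have cop: "coprime a p" using p(1) a
    by (metis coprime_commute dvd_imp_le not_le prime_imp_coprime less_le_trans zero_less_numeral)
  have "\<not> [tetration a (Suc k) = tetration a k] (mod p ^ 2)"
  proof
    assume eq: "[tetration a (Suc k) = tetration a k] (mod p ^ 2)"
    define n where "n = tetration a (Suc j) - tetration a j"
    have n: "tetration a (Suc j) = tetration a j + n"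
      using tetration_less_Suc[OF a(1), of j] by (simp add: n_def)
    have "[a ^ tetration a j * a ^ n = a ^ tetration a j * 1] (mod p ^ 2)"
      using eq n unfolding j
      by (metis mult_1_right power_add tetration.simps(2))
    moreover have "coprime (a ^ tetration a j) (p ^ 2)" using cop by simp
    ultimately have "[a ^ n = 1] (mod p ^ 2)" using cong_mult_lcancel_nat by blast
    then have on: "ord (p ^ 2) a dvd n" by (simp only: ord_divides)
    have "\<not> p dvd n"
    proof
      assume "p dvd n"
      then have "[tetration a j + n = tetration a j + 0] (mod p)"
        by (intro cong_add) (auto simp: cong_0_iff)
      then show False using nE n by simp
    qed
    then have "\<not> p dvd ord (p ^ 2) a" using on dvd_trans by blast
    then have cop': "coprime (ord (p ^ 2) a) p"
      using p(1) prime_imp_coprime coprime_commute by blast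
    have "[a ^ totient (p ^ 2) = 1] (mod p ^ 2)" using cop by (intro euler_theorem) simp
    \<comment> \<open>The order divides the totient p(p - 1) of p^2; being coprime to p, it divides
      p - 1, contrary to the choice of \<open>a\<close>.\<close>
    then have "ord (p ^ 2) a dvd p * (p - 1)"
      using totient_prime_power[OF p(1), of 2] by (simp add: ord_divides')
    then have "ord (p ^ 2) a dvd p - 1" using cop' coprime_dvd_mult_right_iff by blast
    then show False using a(3) by (simp add: ord_divides')
  qed
  then show ?thesis using k j by (auto simp: tower_separates_def)
qed

lemma exists_tower_separates:
  fixes p L :: nat
  assumes p: "prime p" "p < 2 ^ L"
  shows "\<exists>a k. 0 < a \<and> a \<le> (64 * L\<^sup>2) ^ 4 \<and> 0 < k \<and> k \<le> (64 * L\<^sup>2) ^ 4 \<and> tower_separates p a k"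
proof -
  let ?z = "64 * L\<^sup>2"
  have p2: "p \<ge> 2" using p(1) by (rule prime_ge_2_nat)
  have L: "L > 0" using p p2 by (cases L) auto
  have Ly: "2 * L \<le> ?z ^ 4"
  proof -
    have "2 * L \<le> ?z" using L by (simp add: power2_eq_square)
    also have "?z \<le> ?z ^ 4" using L by (intro self_le_power) auto
    finally show ?thesis .
  qed
  show ?thesis
  proof (cases "p \<le> ?z ^ 4")
    case True
    have d: "p ^ 2 dvd p ^ p" using p2 by (rule le_imp_power_dvd)
    have "\<not> p ^ 2 dvd p"
    proof
      assume "p ^ 2 dvd p"
      then have "p ^ 2 \<le> p" using p2 by (intro dvd_imp_le) auto
      then show False using p2 by (simp add: power2_eq_square)
    qed
    then have "\<not> [p ^ p = p] (mod p ^ 2)" using d cong_dvd_iff by blast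
    moreover have "[p ^ p = p] (mod p)" using p2 by (auto simp: cong_def dvd_eq_mod_eq_0 [symmetric])
    ultimately have "tower_separates p p 1" by (simp add: tower_separates_def)
    then show ?thesis using True p2 Ly L by (intro exI[of _ p] exI[of _ 1]) auto
  next
    case False
    have "\<exists>a \<le> ?z ^ 4. 2 \<le> a \<and> \<not> [a ^ (p - 1) = 1] (mod p ^ 2)"
    proof (rule exists_small_nonfermat_base[OF p(1)])
      have "0 < L\<^sup>2" using L by simp
      then show "1 < ?z" by linarith
      show "?z ^ 4 < p" using False by simp
      \<comment> \<open>This allows t = 24 + 8L, and the factor 64 in \<open>?z\<close> is large
        enough for tL < \<open>?z\<close>.\<close>
      have "L \<le> 2 ^ L" using less_exp[of L] by simp
      then have "L\<^sup>2 \<le> (2 ^ L)\<^sup>2" by (rule power_mono) simp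
      then have "?z \<le> 2 ^ (6 + 2 * L)" by (simp add: power_add power_mult [symmetric] mult.commute)
      then have "?z ^ 4 \<le> (2 ^ (6 + 2 * L)) ^ 4" by (rule power_mono) simp
      then show "?z ^ 4 \<le> 2 ^ (24 + 8 * L)" by (simp add: power_mult [symmetric] algebra_simps)
      show "p \<le> 2 ^ L" using p(2) by simp
      show "(24 + 8 * L) * L < ?z"
      proof -
        have "L \<le> L\<^sup>2" using L by (simp add: power2_eq_square)
        moreover have "0 < L\<^sup>2" using L by simp
        ultimately have "24 * L + 8 * L\<^sup>2 < 64 * L\<^sup>2" by linarith
        then show ?thesis by (simp add: algebra_simps power2_eq_square)
      qed
    qed
    then obtain a where a: "a \<le> ?z ^ 4" "2 \<le> a" "\<not> [a ^ (p - 1) = 1] (mod p ^ 2)" by blast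
    then obtain k where "0 < k" "k \<le> 2 * L" "tower_separates p a k"
      using tower_separates_nonfermat_base[OF p a(2) _ a(3)] False by (meson not_le le_less_trans)
    then show ?thesis using a Ly by (intro exI[of _ a] exI[of _ k]) auto
  qed
qed

subsection \<open>The descent to the squarefree part\<close>

text \<open>Adding \<open>N\<close> before subtracting keeps the natural difference from being
  truncated and does not change it modulo \<open>N\<close>.\<close>

definition tower_gap :: "nat \<Rightarrow> nat \<Rightarrow> nat \<Rightarrow> nat" where
  "tower_gap N a k = tetration a (Suc k) mod N + N - tetration a k mod N"

definition strip_square :: "nat \<Rightarrow> nat \<Rightarrow> nat" where
  "strip_square M d = (let g = gcd M d; h = gcd g (M div g) in M div (h * h))"

primrec sweep :: "nat \<Rightarrow> nat \<Rightarrow> nat \<Rightarrow> nat \<Rightarrow> nat" where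
  "sweep N y 0 M = M"
| "sweep N y (Suc i) M =
     sweep N y i (strip_square M (tower_gap N (i div y mod y + 1) (i mod y + 1)))"

lemma strip_square_decomp:
  assumes "M > 0"
  obtains h where "M = strip_square M d * h\<^sup>2" "h = gcd (gcd M d) (M div gcd M d)"
proof -
  let ?g = "gcd M d"
  define h where "h = gcd ?g (M div ?g)"
  have "h * h dvd ?g * (M div ?g)" unfolding h_def by (intro mult_dvd_mono gcd_dvd1 gcd_dvd2)
  then have "h * h dvd M" by simp
  then have "M = strip_square M d * h\<^sup>2"
    by (simp add: strip_square_def Let_def h_def [symmetric] power2_eq_square)
  then show thesis using that h_def by blast
qed

text \<open>Here p divides g = gcd(M, d) exactly once while p^2 divides M, so p also divides M/g and
  therefore h.\<close>

lemma strip_square_separated: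
  assumes N: "N > 0" and M: "M dvd N" "p\<^sup>2 dvd M" and p: "prime p" and s: "tower_separates p a k"
  shows "p * strip_square M (tower_gap N a k) dvd M"
proof -
  let ?d = "tower_gap N a k"
  let ?g = "gcd M ?d"
  have M0: "M > 0" using N M(1) by (metis dvd_pos_nat)
  have pN: "p\<^sup>2 dvd N" using M dvd_trans by blast
  have gap: "[?d + tetration a k = tetration a (Suc k)] (mod q)" if "q dvd N" for q
  proof -
    have "tetration a k mod N \<le> N" using N by (simp add: less_imp_le)
    then have "?d + tetration a k mod N = tetration a (Suc k) mod N + N"
      by (simp add: tower_gap_def)
    then have "[?d + tetration a k = tetration a (Suc k)] (mod N)"
      by (metis cong_def mod_add_right_eq mod_add_self2 mod_mod_trivial)
    then show ?thesis using that cong_dvd_modulus_nat by blast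
  qed
  have "p dvd ?d"
  proof -
    have "p dvd N" using pN by (metis dvd_trans dvd_triv_left power2_eq_square)
    then have "[?d + tetration a k = tetration a k] (mod p)"
      using gap s cong_trans unfolding tower_separates_def by blast
    then show ?thesis by (simp add: cong_add_rcancel_0_nat cong_0_iff)
  qed
  then have pg: "p dvd ?g" using M(2) by (metis dvd_trans dvd_triv_left power2_eq_square gcd_greatest)
  have "\<not> p\<^sup>2 dvd ?d"
  proof
    assume "p\<^sup>2 dvd ?d"
    then have "[?d + tetration a k = tetration a k] (mod p\<^sup>2)"
      by (simp add: cong_add_rcancel_0_nat cong_0_iff)
    then show False using gap[OF pN] s cong_trans cong_sym unfolding tower_separates_def by blast
  qed
  then have npg: "\<not> p\<^sup>2 dvd ?g" using dvd_trans gcd_dvd2 by blast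
  have "p dvd M div ?g"
  proof (rule ccontr)
    assume "\<not> p dvd M div ?g"
    then have "coprime (p\<^sup>2) (M div ?g)" using p prime_imp_coprime by auto
    moreover have "p\<^sup>2 dvd ?g * (M div ?g)" using M(2) by simp
    ultimately show False using npg coprime_dvd_mult_left_iff by blast
  qed
  with pg have ph: "p dvd gcd ?g (M div ?g)" by (rule gcd_greatest)
  obtain h where h: "M = strip_square M ?d * h\<^sup>2" "h = gcd ?g (M div ?g)"
    using strip_square_decomp[OF M0] .
  have "p dvd h\<^sup>2" using ph h(2) by (simp add: power2_eq_square)
  then have "strip_square M ?d * p dvd strip_square M ?d * h\<^sup>2" by (rule mult_dvd_mono[OF dvd_refl])
  then show ?thesis using h(1) by (metis mult.commute)
qed

lemma sweep_decomp: "M > 0 \<Longrightarrow> \<exists>s. M = sweep N y i M * s\<^sup>2"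
proof (induction i arbitrary: M)
  case 0
  show ?case by (intro exI[of _ 1]) simp
next
  case (Suc i)
  let ?d = "tower_gap N (i div y mod y + 1) (i mod y + 1)"
  obtain h where h: "M = strip_square M ?d * h\<^sup>2"
    using strip_square_decomp[OF Suc.prems] by blast
  then have "strip_square M ?d > 0" using Suc.prems by (metis gr0I mult_0)
  then obtain s where "strip_square M ?d = sweep N y (Suc i) M * s\<^sup>2"
    using Suc.IH by auto
  then have "M = sweep N y (Suc i) M * (s * h)\<^sup>2"
    using h by (metis mult.assoc power_mult_distrib)
  then show ?case ..
qed

text \<open>
  The counter \<open>i\<close> encodes the round \<open>q\<close> and the pair \<open>(a, k)\<close> in base \<open>y\<close>. A pair that separates
  \<open>p\<close> costs \<open>M\<close> one factor \<open>p\<close> in each of the \<open>y\<close> rounds, unless \<open>p\<^sup>2\<close> has stopped dividing \<open>M\<close>.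
\<close>

lemma sweep_separated:
  assumes N: "N > 0" and p: "prime p" and ak: "a < y" "k < y"
    and s: "tower_separates p (a + 1) (k + 1)"
  shows "M dvd N \<Longrightarrow>
    (\<And>q. q < y \<Longrightarrow> i \<le> q * y\<^sup>2 + a * y + k \<Longrightarrow> p\<^sup>2 dvd M \<Longrightarrow> p ^ (y - q) * M dvd N) \<Longrightarrow>
    p\<^sup>2 dvd sweep N y i M \<Longrightarrow> p ^ y * sweep N y i M dvd N"
proof (induction i arbitrary: M)
  case 0
  then show ?case using 0(2)[of 0] ak by simp
next
  case (Suc i)
  define M' where "M' = strip_square M (tower_gap N (i div y mod y + 1) (i mod y + 1))"
  have "M > 0" using N Suc.prems(1) by (metis dvd_pos_nat)
  then have M': "M' dvd M" unfolding M'_def using strip_square_decomp by (metis dvd_triv_left)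
  \<comment> \<open>The pair is visited in round \<open>q\<close> at index
    \<open>q * y\<^sup>2 + a * y + k\<close>. The counter runs downwards, so once it is at or below
    this index the rounds q, ..., y - 1 have each removed a factor p.\<close>
  have "p ^ (y - q) * M' dvd N"
    if q: "q < y" "i \<le> q * y\<^sup>2 + a * y + k" "p\<^sup>2 dvd M'" for q
  proof -
    have pM: "p\<^sup>2 dvd M" using q(3) M' dvd_trans by blast
    show ?thesis
    proof (cases "i = q * y\<^sup>2 + a * y + k")
      case False
      then have "p ^ (y - q) * M dvd N" using Suc.prems(2)[OF q(1) _ pM] q(2) by simp
      then show ?thesis using M' by (meson dvd_refl dvd_trans mult_dvd_mono)
    next
      case True
      then have i: "i = (q * y + a) * y + k" by (simp add: algebra_simps power2_eq_square)
      then have "i mod y = k" using ak by simp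
      moreover have "i div y = q * y + a" using i ak by simp
      then have "i div y mod y = a" using ak by simp
      ultimately have "p * M' dvd M"
        unfolding M'_def using strip_square_separated[OF N Suc.prems(1) pM p s] by simp
      then have "p ^ (y - Suc q) * (p * M') dvd p ^ (y - Suc q) * M" by simp
      also have "p ^ (y - Suc q) * M dvd N"
      \<comment> \<open>For q = y - 1 this is the first visit, and the power of p is still
        1.\<close>
      proof (cases "Suc q < y")
        case True
        have "y\<^sup>2 \<ge> 1" using ak by (simp add: Suc_le_eq)
        then have "Suc i \<le> Suc q * y\<^sup>2 + a * y + k" using \<open>i = q * y\<^sup>2 + a * y + k\<close> by simp
        then show ?thesis using Suc.prems(2)[OF True _ pM] by blast
      qed (use Suc.prems(1) in simp)
      finally show ?thesis using q(1) by (metis Suc_diff_Suc mult.assoc power_Suc2)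
    qed
  qed
  moreover have "M' dvd N" using M' Suc.prems(1) dvd_trans by blast
  ultimately show ?case using Suc.IH[of M'] Suc.prems(3) by (simp add: M'_def)
qed

lemma less_two_power_bit_length: "n < 2 ^ bit_length n"
  using floorlog_le_iff[of 2 n "floorlog 2 n"] by simp

text \<open>With this bound for \<open>y\<close>, \<open>exists_tower_separates\<close> covers all primes below \<open>2 ^ L\<close>.\<close>

definition range_bound :: "nat \<Rightarrow> nat" where
  "range_bound L = (64 * L\<^sup>2) ^ 4"

lemma squarefree_part_unique:
  fixes N M s :: nat
  assumes N: "N > 0" "N = M * s\<^sup>2" and M: "squarefree M"
  shows "squarefree_part N = M"
proof -
  have "s dvd square_part N" using N by (simp add: dvd_square_part_iff)
  then obtain t where t: "square_part N = s * t" ..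
  have "M * s\<^sup>2 = squarefree_part N * t\<^sup>2 * s\<^sup>2"
    using squarefree_decompose[of N] N(2) t by (metis mult.assoc mult.commute power_mult_distrib)
  moreover have "s\<^sup>2 \<noteq> 0" using N by auto
  ultimately have eq: "M = squarefree_part N * t\<^sup>2" by (metis mult_right_cancel)
  then have "t dvd 1" using M by (metis dvd_triv_right squarefreeD)
  then show ?thesis using eq by simp
qed

text \<open>If p^2 survived all \<open>y\<close> rounds, p^y would divide \<open>N\<close>; but
  \<open>y\<close> is at least the bit length of \<open>N\<close>, so p^y exceeds
  \<open>N\<close>.\<close>

lemma sweep_eq_sqf_part:
  assumes N: "N > 0" and y: "y = range_bound (bit_length N)"
  shows "sweep N y (y ^ 3) N = sqf_part N"
proof -
  let ?L = "bit_length N"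
  let ?M = "sweep N y (y ^ 3) N"
  have NL: "N < 2 ^ ?L" by (rule less_two_power_bit_length)
  then have L: "?L > 0" using N by (cases ?L) auto
  have "?L * 1 \<le> ?L * (64 * ?L)" using L by (intro mult_le_mono2) simp
  then have "?L \<le> 64 * ?L\<^sup>2" by (simp add: power2_eq_square)
  also have "\<dots> \<le> y" unfolding y range_bound_def using L by (intro self_le_power) auto
  finally have Ly: "?L \<le> y" .
  obtain s where s: "N = ?M * s\<^sup>2" using sweep_decomp[OF N] by blast
  have M0: "?M > 0" using s N by (metis gr0I mult_0)
  have "\<not> p\<^sup>2 dvd ?M" if p: "prime p" for p
  proof
    assume pM: "p\<^sup>2 dvd ?M"
    then have "p\<^sup>2 dvd N" using s by (metis dvd_mult2)
    then have "p dvd N" by (metis dvd_trans dvd_triv_left power2_eq_square)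
    then have "p \<le> N" using N by (rule dvd_imp_le)
    then have "p < 2 ^ ?L" using NL by linarith
    then obtain a k where ak: "0 < a" "a \<le> y" "0 < k" "k \<le> y" "tower_separates p a k"
      using exists_tower_separates[OF p] y unfolding range_bound_def by blast
    have "p ^ y * ?M dvd N"
    proof (rule sweep_separated[OF N p _ _ _ dvd_refl _ pM])
      show "a - 1 < y" "k - 1 < y" using ak by auto
      show "tower_separates p (a - 1 + 1) (k - 1 + 1)" using ak by simp
      \<comment> \<open>The counter starts above every index with q < y, so no visit has been passed
        yet and the assumption is contradictory.\<close>
      fix q assume q: "q < y" "y ^ 3 \<le> q * y\<^sup>2 + (a - 1) * y + (k - 1)"
      have "(a - 1) * y + (k - 1) < (a - 1) * y + y" using ak by simp
      also have "\<dots> = a * y" using ak by (cases a) auto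
      also have "\<dots> \<le> y\<^sup>2" using ak by (simp add: power2_eq_square)
      finally have "q * y\<^sup>2 + (a - 1) * y + (k - 1) < Suc q * y\<^sup>2" by simp
      also have "\<dots> \<le> y * y\<^sup>2" using q(1) by (intro mult_right_mono) auto
      also have "\<dots> = y ^ 3" by (simp add: power_eq_if)
      finally show "p ^ (y - q) * N dvd N" using q(2) by simp
    qed
    then have "p ^ y \<le> N" using N by (meson dvd_imp_le dvd_mult_left)
    moreover have "2 ^ ?L \<le> (2::nat) ^ y" using Ly by simp
    moreover have "2 ^ y \<le> p ^ y" using p prime_ge_2_nat by (intro power_mono) auto
    ultimately show False using NL by linarith
  qed
  then have "squarefree ?M" using M0 by (subst squarefree_factorial_semiring) auto
  then have "squarefree_part N = ?M"
    using squarefree_part_unique[of N ?M s] s N by simp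
  then show ?thesis using sqf_part_eq_squarefree_part[OF N] by simp
qed

subsection \<open>Reasoning about costs\<close>

text \<open>Each query is charged at least 1 plus its size, so a time bound also bounds the number
  and sizes of the queries.\<close>

lemma exec_queries_bounded:
  assumes "exec f c s t T qs"
  shows "length qs \<le> T \<and> (\<forall>q\<in>set qs. bit_size q \<le> T)"
  using assms by (induction rule: exec.induct) (auto intro: trans_le_add1 trans_le_add2 le_SucI)

text \<open>
  Costs are counted in units of \<open>4 (W + 1)\<^sup>2\<close>, which pays for any single instruction whose
  operands have at most \<open>W\<close> bits.
\<close>

definition unit_cost :: "nat \<Rightarrow> nat" where
  "unit_cost W = 4 * (W + 1)\<^sup>2"

text \<open>A total-correctness judgement. With the start state as an argument, a run of a second
  program can stand in the postcondition of the first, as in \<open>runs_Seq\<close>.\<close>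

definition runs :: "(nat list \<Rightarrow> nat) \<Rightarrow> nat \<Rightarrow> com \<Rightarrow> nat \<Rightarrow> state \<Rightarrow> (state \<Rightarrow> bool) \<Rightarrow> bool" where
  "runs f W c n s Q \<longleftrightarrow> (\<exists>t T qs. exec f c s t T qs \<and> T \<le> n * unit_cost W \<and> Q t)"

lemma bit_length_le: "v < 2 ^ W \<Longrightarrow> bit_length v \<le> W"
  by (simp add: floorlog_leI)

lemma bit_length_pos: "0 < n \<Longrightarrow> 0 < bit_length n"
  by (simp add: floorlog_def)

text \<open>The factor 4 pays for a query: three arguments and one answer.\<close>

lemma linear_le_unit_cost: "1 + 4 * W \<le> unit_cost W"
  by (simp add: unit_cost_def power2_eq_square algebra_simps)

lemma runs_mono: "runs f W c n s P \<Longrightarrow> n \<le> m \<Longrightarrow> (\<And>t. P t \<Longrightarrow> Q t) \<Longrightarrow> runs f W c m s Q"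
  unfolding runs_def by (meson mult_le_mono1 order_trans)

lemma runs_Skip: "Q s \<Longrightarrow> runs f W Skip 1 s Q"
  unfolding runs_def using exec.Skip[of f s] linear_le_unit_cost[of W] by fastforce

lemma runs_Load: "v < 2 ^ W \<Longrightarrow> Q (s(x := v)) \<Longrightarrow> runs f W (Load x v) 1 s Q"
  unfolding runs_def
  by (intro exI conjI, rule exec.Load)
    (use linear_le_unit_cost[of W] bit_length_le[of v W] in auto)

lemma arith_cost_le:
  assumes "m < 2 ^ W" "n < 2 ^ W"
  shows "arith_cost b m n \<le> unit_cost W"
proof -
  have l: "bit_length m \<le> W" "bit_length n \<le> W" using assms by (auto intro: bit_length_le)
  have "1 + bit_length m + bit_length n \<le> unit_cost W"
    using l linear_le_unit_cost[of W] by simp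
  moreover have "(1 + bit_length m) * (1 + bit_length n) \<le> (1 + W) * (1 + W)"
    using l by (intro mult_mono) auto
  then have "(1 + bit_length m) * (1 + bit_length n) \<le> unit_cost W"
    by (simp add: unit_cost_def power2_eq_square)
  ultimately show ?thesis by (cases b) (simp_all only: arith_cost.simps)
qed

lemma runs_Arith:
  assumes "s y < 2 ^ W" "s z < 2 ^ W" "Q (s(x := arith_val b (s y) (s z)))"
  shows "runs f W (Arith b x y z) 1 s Q"
  unfolding runs_def mult_1_left using exec.Arith arith_cost_le[OF assms(1,2)] assms(3) by blast

lemma runs_Query:
  assumes "s u < 2 ^ W" "s v < 2 ^ W" "s w < 2 ^ W" "f [s u, s v, s w] < 2 ^ W"
    "Q (s(x := f [s u, s v, s w]))"
  shows "runs f W (Query x [u, v, w]) 1 s Q"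
proof -
  let ?q = "[s u, s v, s w]"
  have "exec f (Query x [u, v, w]) s (s(x := f ?q)) (1 + bit_size ?q + bit_length (f ?q)) [?q]"
    by (rule exec.Query) simp
  moreover have "1 + bit_size ?q + bit_length (f ?q) \<le> 1 * unit_cost W"
    using assms(1-4)[THEN bit_length_le] linear_le_unit_cost[of W] by (simp add: bit_size_def)
  ultimately show ?thesis unfolding runs_def using assms(5) by blast
qed

lemma runs_Seq:
  assumes "runs f W c n s (\<lambda>t. runs f W d m t Q)"
  shows "runs f W (Seq c d) (n + m) s Q"
proof -
  obtain t T qs where 1: "exec f c s t T qs" "T \<le> n * unit_cost W" "runs f W d m t Q"
    using assms unfolding runs_def by blast
  then obtain u U rs where 2: "exec f d t u U rs" "U \<le> m * unit_cost W" "Q u"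
    unfolding runs_def by blast
  have "exec f (Seq c d) s u (T + U) (qs @ rs)" using 1 2 by (intro exec.Seq)
  moreover have "T + U \<le> (n + m) * unit_cost W" using 1(2) 2(2) by (simp add: algebra_simps)
  ultimately show ?thesis unfolding runs_def using 2(3) by blast
qed

text \<open>The variant \<open>V\<close> bounds the number of iterations. Each iteration costs one
  unit for the test besides the body, and the last unit is for the failing test.\<close>

lemma runs_Loop:
  assumes "I s"
    and body: "\<And>s. I s \<Longrightarrow> s x \<noteq> 0 \<Longrightarrow> s x < 2 ^ W \<and> runs f W c n s (\<lambda>t. I t \<and> V t < V s)"
  shows "runs f W (Loop x c) ((n + 1) * V s + 1) s (\<lambda>t. I t \<and> t x = 0)"
  using assms(1)
proof (induction "V s" arbitrary: s rule: less_induct)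
  case less
  have C: "1 + W \<le> unit_cost W" using linear_le_unit_cost[of W] by simp
  show ?case
  proof (cases "s x = 0")
    case True
    then have "exec f (Loop x c) s s 1 []" by (rule exec.Loop_zero)
    moreover have "1 \<le> ((n + 1) * V s + 1) * unit_cost W" using C by simp
    ultimately show ?thesis unfolding runs_def using less.prems True by blast
  next
    case False
    obtain t T qs where 1: "exec f c s t T qs" "T \<le> n * unit_cost W" "I t" "V t < V s"
      using body[OF less.prems False] unfolding runs_def by blast
    obtain u U rs where 2: "exec f (Loop x c) t u U rs"
        "U \<le> ((n + 1) * V t + 1) * unit_cost W" "I u" "u x = 0"
      using less.hyps[OF 1(4,3)] unfolding runs_def by blast
    have "exec f (Loop x c) s u (1 + bit_length (s x) + T + U) (qs @ rs)"
      using False 1(1) 2(1) by (rule exec.Loop_nonzero)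
    moreover have "1 + bit_length (s x) + T + U \<le> ((n + 1) * V s + 1) * unit_cost W"
    proof -
      have "bit_length (s x) \<le> W" using body[OF less.prems False] bit_length_le by blast
      then have "1 + bit_length (s x) + T + U
          \<le> unit_cost W + n * unit_cost W + ((n + 1) * V t + 1) * unit_cost W"
        using C 1(2) 2(2) by linarith
      also have "\<dots> = ((n + 1) * Suc (V t) + 1) * unit_cost W" by (simp add: algebra_simps)
      also have "\<dots> \<le> ((n + 1) * V s + 1) * unit_cost W"
        using 1(4) by (intro mult_le_mono1 add_le_mono1 mult_le_mono2) simp
      finally show ?thesis .
    qed
    ultimately show ?thesis unfolding runs_def using 2(3,4) by blast
  qed
qed

primrec block :: "com list \<Rightarrow> com" where
  "block [] = Skip"
| "block (c # cs) = Seq c (block cs)"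

lemma runs_block_Nil: "Q s \<Longrightarrow> runs f W (block []) 1 s Q"
  unfolding block.simps by (rule runs_Skip)

lemma runs_block_Cons:
  "runs f W c n s P \<Longrightarrow> (\<And>t. P t \<Longrightarrow> runs f W (block cs) m t Q) \<Longrightarrow>
    runs f W (block (c # cs)) (n + m) s Q"
  by (auto intro!: runs_Seq elim: runs_mono)

lemma runs_block_Load:
  "v < 2 ^ W \<Longrightarrow> runs f W (block cs) m (s(x := v)) Q \<Longrightarrow>
    runs f W (block (Load x v # cs)) (1 + m) s Q"
  unfolding block.simps by (intro runs_Seq runs_Load)

lemma runs_block_Arith:
  "s y < 2 ^ W \<Longrightarrow> s z < 2 ^ W \<Longrightarrow>
    runs f W (block cs) m (s(x := arith_val b (s y) (s z))) Q \<Longrightarrow>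
    runs f W (block (Arith b x y z # cs)) (1 + m) s Q"
  unfolding block.simps by (intro runs_Seq runs_Arith)

text \<open>
  Naming the values keeps the size of symbolic states linear in the length of a program;
  substituting register lookups, as in the previous rule, doubles the state at each step.
\<close>

lemma runs_block_Arith_val:
  "s y = m \<Longrightarrow> s z = n \<Longrightarrow> m < 2 ^ W \<Longrightarrow> n < 2 ^ W \<Longrightarrow> arith_val b m n = v \<Longrightarrow>
    runs f W (block cs) k (s(x := v)) Q \<Longrightarrow>
    runs f W (block (Arith b x y z # cs)) (1 + k) s Q"
  using runs_block_Arith by blast

lemma runs_block_Query_val:
  "s u = a \<Longrightarrow> s v = b \<Longrightarrow> s w = c \<Longrightarrow> a < 2 ^ W \<Longrightarrow> b < 2 ^ W \<Longrightarrow> c < 2 ^ W \<Longrightarrow>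
    f [a, b, c] = r \<Longrightarrow> r < 2 ^ W \<Longrightarrow> runs f W (block cs) k (s(x := r)) Q \<Longrightarrow>
    runs f W (block (Query x [u, v, w] # cs)) (1 + k) s Q"
  unfolding block.simps by (intro runs_Seq runs_Query) auto

subsection \<open>The program\<close>

text \<open>
  Register use: 0 holds \<open>M\<close> (initially \<open>N\<close>), 1 holds \<open>N\<close>, 2 the counter, 3 the bound \<open>y\<close>,
  8 the constant 1 and 9 the constant 0; the others are scratch.
\<close>

definition gcd_prog :: com where
  "gcd_prog = Loop 11 (block [Arith Rem 12 10 11, Arith Plus 10 11 9, Arith Plus 11 12 9])"

text \<open>After decrementing the counter, its two lowest digits in base y, plus 1, give a in
  register 4 and k in register 5. The queries at heights k and k + 1 yield \<open>tower_gap\<close>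
  in register 11, where \<open>strip_prog\<close> expects it.\<close>

definition gap_prog :: com where
  "gap_prog = block
    [Arith Minus 2 2 8,
     Arith Quot 4 2 3, Arith Rem 4 4 3, Arith Plus 4 4 8,
     Arith Rem 5 2 3, Arith Plus 5 5 8,
     Query 6 [4, 5, 1],
     Arith Plus 5 5 8,
     Query 7 [4, 5, 1],
     Arith Plus 7 7 1, Arith Minus 11 7 6]"

definition strip_prog :: com where
  "strip_prog = block
    [Arith Plus 10 0 9, gcd_prog,
     Arith Quot 11 0 10, gcd_prog,
     Arith Times 10 10 10, Arith Quot 0 0 10]"

text \<open>Repeated halving counts the bit length L in register 2. The products that follow are
  L^2, z = 64 L^2, z^2, y = z^4, y^2 and the initial counter y^3.\<close>

definition bound_prog :: com where
  "bound_prog = block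
    [Load 8 1, Arith Plus 1 0 9, Arith Plus 4 0 9, Load 5 2,
     Loop 4 (block [Arith Quot 4 4 5, Arith Plus 2 2 8]),
     Arith Times 2 2 2, Load 5 64, Arith Times 2 5 2, Arith Times 2 2 2,
     Arith Times 3 2 2, Arith Times 2 3 3, Arith Times 2 2 3]"

definition sqf_prog :: com where
  "sqf_prog = block [bound_prog, Loop 2 (block [gap_prog, strip_prog])]"

lemma bit_length_less:
  assumes "2 * m \<le> n" "n > 0"
  shows "bit_length m < bit_length n"
proof -
  have "m \<le> n div 2" using assms by simp
  then have "bit_length m \<le> bit_length (n div 2)" by (rule floorlog_mono)
  also have "\<dots> < bit_length n" using assms(2) compute_floorlog[of 2 n] by simp
  finally show ?thesis .
qed

lemma runs_gcd_prog:
  assumes "s 9 = 0" "s 10 < 2 ^ W" "s 11 < 2 ^ W"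
  shows "runs f W gcd_prog (10 * W + 1) s
    (\<lambda>t. t 10 = gcd (s 10) (s 11) \<and> (\<forall>r. r \<notin> {10, 11, 12} \<longrightarrow> t r = s r))"
proof -
  \<comment> \<open>With r = a mod b, a Euclidean step replaces (b, r) by (r, b mod r). As b mod r
    \<le> b/2, the sum of the two bit lengths decreases.\<close>
  define V where "V = (\<lambda>s :: state. if s 11 = 0 then 0 else bit_length (s 11) + bit_length (s 10 mod s 11))"
  define I where "I = (\<lambda>t :: state. t 10 < 2 ^ W \<and> t 11 < 2 ^ W \<and>
      gcd (t 10) (t 11) = gcd (s 10) (s 11) \<and> (\<forall>r. r \<notin> {10, 11, 12} \<longrightarrow> t r = s r))"
  have "runs f W gcd_prog ((4 + 1) * V s + 1) s (\<lambda>t. I t \<and> t 11 = 0)"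
    unfolding gcd_prog_def
  proof (rule runs_Loop)
    show "I s" using assms by (simp add: I_def)
    fix t assume t: "I t" "t 11 \<noteq> 0"
    let ?a = "t 10" and ?b = "t 11"
    have t9: "t 9 = 0" using t(1) assms(1) by (simp add: I_def)
    have lt: "?a < 2 ^ W" "?b < 2 ^ W" using t(1) by (auto simp: I_def)
    have r: "?a mod ?b < ?b" using t(2) by simp
    let ?t = "t(12 := ?a mod ?b, 10 := ?b, 11 := ?a mod ?b)"
    have "I ?t"
      using t(1) r lt unfolding I_def by (auto simp: gcd.commute gcd_red_nat [symmetric])
    moreover have "V ?t < V t"
    proof (cases "?a mod ?b = 0")
      case True
      then show ?thesis using t(2) by (simp add: V_def bit_length_pos)
    next
      case False
      have "2 * (?b mod (?a mod ?b)) \<le> ?b"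
      proof -
        let ?r = "?a mod ?b"
        have "?b mod ?r < ?r" using False by simp
        moreover have "?b mod ?r + ?r \<le> ?b"
        proof -
          have "?b div ?r \<ge> 1" using r False by (simp add: div_greater_zero_iff Suc_le_eq)
          then have "?r * 1 \<le> ?r * (?b div ?r)" by (rule mult_le_mono2)
          then show ?thesis using mult_div_mod_eq[of ?r ?b] by linarith
        qed
        ultimately show ?thesis by linarith
      qed
      then have "bit_length (?b mod (?a mod ?b)) < bit_length ?b"
        using t(2) by (intro bit_length_less) auto
      then show ?thesis using False t(2) by (simp add: V_def)
    qed
    ultimately have post: "I ?t \<and> V ?t < V t" by blast
    \<comment> \<open>The last unit in such sums pays for the \<open>Skip\<close> that ends a
      \<open>block\<close>.\<close>
    have "runs f W (block [Arith Rem 12 10 11, Arith Plus 10 11 9, Arith Plus 11 12 9])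
        (1 + (1 + (1 + 1))) t (\<lambda>u. I u \<and> V u < V t)"
      by (intro runs_block_Arith runs_block_Nil) (use lt r t9 post in \<open>auto\<close>)
    then show "t 11 < 2 ^ W \<and>
        runs f W (block [Arith Rem 12 10 11, Arith Plus 10 11 9, Arith Plus 11 12 9])
          4 t (\<lambda>u. I u \<and> V u < V t)"
      using lt by (simp add: numeral_eq_Suc)
  qed
  then show ?thesis
  proof (rule runs_mono)
    have "s 10 mod s 11 < 2 ^ W" using assms(2) by (meson le_less_trans mod_less_eq_dividend)
    then have "V s \<le> 2 * W"
      using assms(3) bit_length_le[of "s 11" W] bit_length_le[of "s 10 mod s 11" W] by (simp add: V_def)
    then show "(4 + 1) * V s + 1 \<le> 10 * W + 1" by simp
  qed (auto simp: I_def)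
qed

lemma runs_gap_prog:
  assumes f: "solves f MTP"
    and s: "s 1 = N" "s 2 = Suc i" "s 3 = y" "s 8 = 1" "s 9 = 0"
    and N: "0 < N" "2 * N < 2 ^ W" and y: "0 < y" "y + 1 < 2 ^ W" and i: "Suc i < 2 ^ W"
  shows "runs f W gap_prog 12 s (\<lambda>t. t 11 = tower_gap N (i div y mod y + 1) (i mod y + 1) \<and>
    t 2 = i \<and> (\<forall>r\<in>{0, 1, 3, 8, 9}. t r = s r))"
proof -
  let ?a = "i div y mod y + 1" and ?k = "i mod y + 1"
  have answer: "f [Suc a, Suc k, N] = tetration (Suc a) (Suc k) mod N" for a k
    using f N(1) unfolding solves_def MTP_def by (auto simp del: tetration.simps)
  have mod: "v mod N < 2 ^ W" "v mod N + N < 2 ^ W" for v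
    using N mod_less_divisor[of N v] by linarith+
  have a: "i div y mod y < y" and k: "i mod y < y" using y by auto
  have a': "Suc (i div y mod y) < 2 ^ W" "i div y mod y < 2 ^ W" using a y by linarith+
  have k': "Suc (Suc (i mod y)) < 2 ^ W" "Suc (i mod y) < 2 ^ W" "i mod y < 2 ^ W" using k y by linarith+
  have iy: "i div y < 2 ^ W" using i by (meson Suc_lessD div_le_dividend le_less_trans)
  have N': "N < 2 ^ W" and y': "y < 2 ^ W" and i': "i < 2 ^ W" and one: "Suc 0 < 2 ^ W"
    using N y i by linarith+
  note [simp] = s s(1)[unfolded One_nat_def] answer mod a' k' iy N' y' i' one i
  note [simp del] = tetration.simps
  have "runs f W gap_prog (1 + (1 + (1 + (1 + (1 + (1 + (1 + (1 + (1 + (1 + (1 + 1))))))))))) s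
    (\<lambda>t. t 11 = tower_gap N ?a ?k \<and> t 2 = i \<and> (\<forall>r\<in>{0, 1, 3, 8, 9}. t r = s r))"
    unfolding gap_prog_def
    apply (rule runs_block_Arith_val, simp, simp, simp, simp, simp)+
    apply (rule runs_block_Query_val, simp, simp, simp, simp, simp, simp, simp, simp)
    apply (rule runs_block_Arith_val, simp, simp, simp, simp, simp)
    apply (rule runs_block_Query_val, simp, simp, simp, simp, simp, simp, simp, simp)
    apply (rule runs_block_Arith_val, simp, simp, simp, simp, simp)+
    apply (rule runs_block_Nil)
    apply (simp add: tower_gap_def)
    done
  then show ?thesis by (rule runs_mono) auto
qed

lemma runs_strip_prog:
  assumes s: "s 9 = 0" and M: "0 < s 0" "s 0 < 2 ^ W" and d: "s 11 < 2 ^ W"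
  shows "runs f W strip_prog (20 * W + 7) s (\<lambda>t. t 0 = strip_square (s 0) (s 11) \<and>
    (\<forall>r\<in>{1, 2, 3, 8, 9}. t r = s r))"
proof -
  let ?M = "s 0"
  let ?g = "gcd ?M (s 11)"
  let ?h = "gcd ?g (?M div ?g)"
  have g: "?g < 2 ^ W" using M gcd_le1_nat[of ?M "s 11"] by linarith
  have Mg: "?M div ?g < 2 ^ W" using M(2) by (meson div_le_dividend le_less_trans)
  have "?g > 0" using M(1) by simp
  then have h: "?h < 2 ^ W" using g gcd_le1_nat[of ?g "?M div ?g"] by linarith
  have "?h * ?h dvd ?g * (?M div ?g)" by (intro mult_dvd_mono gcd_dvd1 gcd_dvd2)
  then have "?h * ?h dvd ?M" by simp
  \<comment> \<open>Since h^2 divides M, squaring does not outgrow the word length.\<close>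
  then have hh: "?h * ?h < 2 ^ W" using M by (meson dvd_imp_le le_less_trans)
  have "runs f W strip_prog (1 + ((10 * W + 1) + (1 + ((10 * W + 1) + (1 + (1 + 1)))))) s
    (\<lambda>t. t 0 = strip_square ?M (s 11) \<and> (\<forall>r\<in>{1, 2, 3, 8, 9}. t r = s r))"
    unfolding strip_prog_def
  proof (rule runs_block_Arith)
    let ?s = "s(10 := arith_val Plus (s 0) (s 9))"
    show "runs f W (block [gcd_prog, Arith Quot 11 0 10, gcd_prog, Arith Times 10 10 10, Arith Quot 0 0 10])
      ((10 * W + 1) + (1 + ((10 * W + 1) + (1 + (1 + 1))))) ?s
      (\<lambda>t. t 0 = strip_square ?M (s 11) \<and> (\<forall>r\<in>{1, 2, 3, 8, 9}. t r = s r))"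
    proof (rule runs_block_Cons[OF runs_gcd_prog], goal_cases)
      case (4 t)
      then have t: "t 10 = ?g" "t 0 = ?M" "t 9 = 0" "\<forall>r\<in>{1, 2, 3, 8, 9}. t r = s r"
        using s by auto
      show ?case
      proof (rule runs_block_Arith)
        show "runs f W (block [gcd_prog, Arith Times 10 10 10, Arith Quot 0 0 10])
          ((10 * W + 1) + (1 + (1 + 1))) (t(11 := arith_val Quot (t 0) (t 10)))
          (\<lambda>t. t 0 = strip_square ?M (s 11) \<and> (\<forall>r\<in>{1, 2, 3, 8, 9}. t r = s r))"
        proof (rule runs_block_Cons[OF runs_gcd_prog], goal_cases)
          case (4 u)
          then have u: "u 10 = ?h" "u 0 = ?M" "\<forall>r\<in>{1, 2, 3, 8, 9}. u r = s r"
            using t by auto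
          show ?case
            by (intro runs_block_Arith runs_block_Nil)
              (use u h hh M in \<open>auto simp: strip_square_def Let_def\<close>)
        qed (use t g Mg in auto)
      qed (use t M g in auto)
    qed (use s M d in auto)
  qed (use s M in auto)
  then show ?thesis by (rule runs_mono) auto
qed

text \<open>The left side is 2^72 L^24, and L < 2^L.\<close>

lemma sweep_counter_bound: "range_bound L ^ 3 < 2 ^ (72 + 24 * L)"
proof -
  have "L ^ 24 < (2 ^ L) ^ 24" using less_exp[of L] by (intro power_strict_mono) auto
  then have "2 ^ 72 * L ^ 24 < 2 ^ 72 * (2 ^ L) ^ 24" by simp
  also have "\<dots> = 2 ^ (72 + 24 * L)" by (simp add: power_add power_mult [symmetric] mult.commute)
  also have "(2::nat) ^ 72 * L ^ 24 = range_bound L ^ 3"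
    by (simp add: range_bound_def power_mult_distrib power_mult [symmetric])
  finally show ?thesis .
qed

lemma runs_bound_prog:
  assumes N: "N > 0" and L: "L = bit_length N" and y: "y = range_bound L" and W: "W = 80 + 24 * L"
  shows "runs f W bound_prog (4 * L + 13) (input_state [N])
    (\<lambda>t. t 0 = N \<and> t 1 = N \<and> t 2 = y ^ 3 \<and> t 3 = y \<and> t 8 = 1 \<and> t 9 = 0)"
proof -
  define z where "z = 64 * (L * L)"
  have L0: "L > 0" using N L by (simp add: bit_length_pos)
  have y_eq: "y = z * z * (z * z)"
    by (simp add: y range_bound_def z_def power_eq_if power2_eq_square)
  have z0: "z > 0" using L0 by (simp add: z_def)
  \<comment> \<open>The final product is the largest value computed from L; the bounds for the
    earlier ones descend from it.\<close>
  have y3: "y * y * y < 2 ^ W"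
  proof -
    have "y ^ 3 < 2 ^ (72 + 24 * L)" unfolding y by (rule sweep_counter_bound)
    also have "\<dots> \<le> 2 ^ W" unfolding W by (intro power_increasing) auto
    finally show ?thesis by (simp add: power3_eq_cube)
  qed
  have mono: "v \<le> v * v" if "0 < v" for v :: nat using that by simp
  have y0: "y > 0" using z0 y_eq by simp
  have "y * y * 1 \<le> y * y * y" using y0 by (intro mult_le_mono2) simp
  then have y2: "y * y < 2 ^ W" using y3 by linarith
  have y1: "y < 2 ^ W" using y2 mono[OF y0] by linarith
  have "z * z \<le> y" unfolding y_eq by (rule mono) (use z0 in simp)
  then have z2: "z * z < 2 ^ W" using y1 by linarith
  have z1: "z < 2 ^ W" using z2 mono[OF z0] by linarith
  have l2: "L * L < 2 ^ W" using z1 by (simp add: z_def)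
  have l1: "L < 2 ^ W" using l2 mono[OF L0] by linarith
  have c: "64 < (2::nat) ^ W"
  proof -
    have "(2::nat) ^ 7 \<le> 2 ^ W" unfolding W by (intro power_increasing) auto
    then show ?thesis by simp
  qed
  have n: "N < 2 ^ W"
  proof -
    have "N < 2 ^ L" unfolding L by (rule less_two_power_bit_length)
    also have "\<dots> \<le> 2 ^ W" unfolding W by (intro power_increasing) auto
    finally show ?thesis .
  qed
  \<comment> \<open>The halvings done and the bits left add up to L.\<close>
  define I where "I = (\<lambda>t :: state. t 0 = N \<and> t 1 = N \<and> t 5 = 2 \<and> t 8 = 1 \<and> t 9 = 0 \<and>
    t 4 < 2 ^ W \<and> t 2 + bit_length (t 4) = L)"
  have loop: "runs f W (Loop 4 (block [Arith Quot 4 4 5, Arith Plus 2 2 8])) ((3 + 1) * L + 1) s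
      (\<lambda>t. I t \<and> t 4 = 0)" if s: "I s" "bit_length (s 4) = L" for s
    unfolding s(2) [symmetric]
  proof (rule runs_Loop[where I = I and V = "\<lambda>s. bit_length (s 4)", OF s(1)])
    fix t assume t: "I t" "t 4 \<noteq> 0"
    then have len: "bit_length (t 4) = bit_length (t 4 div 2) + 1"
      using compute_floorlog[of 2 "t 4"] by simp
    have "t 4 div 2 < 2 ^ W" using t by (auto simp: I_def)
    moreover have "t 2 < 2 ^ W" using t l1 by (auto simp: I_def)
    moreover have "I (t(4 := t 4 div 2, 2 := t 2 + 1))"
      using t len \<open>t 4 div 2 < 2 ^ W\<close> by (auto simp: I_def)
    ultimately have "runs f W (block [Arith Quot 4 4 5, Arith Plus 2 2 8]) (1 + (1 + 1)) t
        (\<lambda>u. I u \<and> bit_length (u 4) < bit_length (t 4))"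
      by (intro runs_block_Arith runs_block_Nil) (use t len c in \<open>auto simp: I_def\<close>)
    then show "t 4 < 2 ^ W \<and> runs f W (block [Arith Quot 4 4 5, Arith Plus 2 2 8]) 3 t
        (\<lambda>u. I u \<and> bit_length (u 4) < bit_length (t 4))"
      using t by (simp add: I_def numeral_3_eq_3)
  qed
  have "runs f W bound_prog (1 + (1 + (1 + (1 + (((3 + 1) * L + 1) +
      (1 + (1 + (1 + (1 + (1 + (1 + (1 + 1)))))))))))) (input_state [N])
    (\<lambda>t. t 0 = N \<and> t 1 = N \<and> t 2 = y ^ 3 \<and> t 3 = y \<and> t 8 = 1 \<and> t 9 = 0)"
    unfolding bound_prog_def
  proof (intro runs_block_Load runs_block_Arith, goal_cases)
    case 7
    show ?case
    proof (rule runs_block_Cons[OF loop], goal_cases)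
      case (3 t)
      then have t: "t 0 = N" "t 1 = N" "t 2 = L" "t 8 = 1" "t 9 = 0"
        by (auto simp: I_def floorlog_eq_zero_iff)
      note [simp] = t t(2)[unfolded One_nat_def] c l1 l2 z1 z2 y1 y2 y3 z_def [symmetric] y_eq [symmetric]
      show ?case
        apply (rule runs_block_Arith_val, simp, simp, simp, simp, simp)
        apply (rule runs_block_Load, simp)
        apply (rule runs_block_Arith_val, simp, simp, simp, simp, simp)+
        apply (rule runs_block_Nil)
        apply (simp add: power3_eq_cube)
        done
    qed (auto simp: I_def input_state_def n L)
  qed (use c n in \<open>auto simp: input_state_def\<close>)
  then show ?thesis by (rule runs_mono) auto
qed

lemma runs_sqf_prog:
  assumes f: "solves f MTP" and N: "N > 0" and L: "L = bit_length N" and W: "W = 80 + 24 * L"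
  shows "runs f W sqf_prog (4 * L + 15 + (20 * W + 21) * range_bound L ^ 3) (input_state [N])
    (\<lambda>t. t 0 = sqf_part N)"
proof -
  define y where "y = range_bound L"
  \<comment> \<open>Sweeping on from the current counter and M gives the answer, so at counter 0
    register 0 holds it.\<close>
  define I where "I = (\<lambda>t :: state. t 1 = N \<and> t 2 \<le> y ^ 3 \<and> t 3 = y \<and> t 8 = 1 \<and> t 9 = 0 \<and>
    t 0 > 0 \<and> t 0 dvd N \<and> sweep N y (t 2) (t 0) = sqf_part N)"
  have L0: "L > 0" using N L by (simp add: bit_length_pos)
  have y0: "y > 0" using L0 by (simp add: y_def range_bound_def)
  \<comment> \<open>The spare factor 2 makes room for 2N and y + 1.\<close>
  have WL: "(2::nat) ^ (72 + 24 * L) * 2 \<le> 2 ^ W"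
  proof -
    have "(2::nat) ^ (72 + 24 * L) * 2 = 2 ^ Suc (72 + 24 * L)" by (simp only: power_Suc2)
    also have "\<dots> \<le> 2 ^ W" unfolding W by (intro power_increasing) auto
    finally show ?thesis .
  qed
  have y3: "y ^ 3 < 2 ^ (72 + 24 * L)" unfolding y_def by (rule sweep_counter_bound)
  have "y \<le> y ^ 3" using y0 by (intro self_le_power) auto
  then have y1: "y + 1 < 2 ^ W" using y3 WL y0 by linarith
  have NW: "2 * N < 2 ^ W"
  proof -
    have "N < 2 ^ L" unfolding L by (rule less_two_power_bit_length)
    also have "\<dots> \<le> 2 ^ (72 + 24 * L)" by (intro power_increasing) auto
    finally show ?thesis using WL by linarith
  qed
  have body: "s 2 < 2 ^ W \<and> runs f W (block [gap_prog, strip_prog]) (20 * W + 20) s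
      (\<lambda>t. I t \<and> t 2 < s 2)" if s: "I s" "s 2 \<noteq> 0" for s
  proof -
    obtain i where i: "s 2 = Suc i" using s(2) by (cases "s 2") auto
    have i': "Suc i < 2 ^ W" using s(1) i y3 WL unfolding I_def by linarith
    have s': "s 1 = N" "s 3 = y" "s 8 = 1" "s 9 = 0" "s 0 > 0" "s 0 dvd N"
        "sweep N y (Suc i) (s 0) = sqf_part N" "Suc i \<le> y ^ 3"
      using s(1) i by (auto simp: I_def)
    have M: "s 0 < 2 ^ W" using dvd_imp_le[OF s'(6) N] NW by linarith
    let ?d = "tower_gap N (i div y mod y + 1) (i mod y + 1)"
    have d: "?d < 2 ^ W"
    proof -
      have "tetration (i div y mod y + 1) (Suc (i mod y + 1)) mod N < N" using N by simp
      then show ?thesis unfolding tower_gap_def using NW by linarith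
    qed
    have "runs f W (block [gap_prog, strip_prog]) (12 + ((20 * W + 7) + 1)) s
      (\<lambda>t. I t \<and> t 2 < s 2)"
    proof (rule runs_block_Cons[OF runs_gap_prog[OF f s'(1) i s'(2-4) N NW y0 y1 i']])
      fix t
      assume t: "t 11 = ?d \<and> t 2 = i \<and> (\<forall>r\<in>{0, 1, 3, 8, 9}. t r = s r)"
      show "runs f W (block [strip_prog]) ((20 * W + 7) + 1) t (\<lambda>t. I t \<and> t 2 < s 2)"
      proof (rule runs_block_Cons[OF runs_strip_prog[of t W f]], goal_cases)
        case (5 u)
        then have u: "u 0 = strip_square (s 0) ?d" "u 1 = N" "u 2 = i" "u 3 = y" "u 8 = 1" "u 9 = 0"
          using t s' by auto
        obtain h where h: "s 0 = strip_square (s 0) ?d * h\<^sup>2"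
          using strip_square_decomp[OF s'(5)] by blast
        then have "strip_square (s 0) ?d > 0" using s'(5) by (metis gr0I mult_0)
        moreover have "strip_square (s 0) ?d dvd N" using h s'(6) by (metis dvd_trans dvd_triv_left)
        ultimately have *: "I u \<and> u 2 < s 2" using u s'(7,8) i by (simp add: I_def)
        show ?case by (rule runs_block_Nil) (rule *)
      qed (use t s' M d in auto)
    qed
    moreover have "12 + ((20 * W + 7) + 1) = 20 * W + 20" by simp
    ultimately show ?thesis using i i' by metis
  qed
  have "runs f W sqf_prog ((4 * L + 13) + (((20 * W + 20 + 1) * y ^ 3 + 1) + 1)) (input_state [N])
    (\<lambda>t. t 0 = sqf_part N)"
    unfolding sqf_prog_def
  proof (rule runs_block_Cons[OF runs_bound_prog[OF N L y_def W]])
    fix t :: state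
    assume t: "t 0 = N \<and> t 1 = N \<and> t 2 = y ^ 3 \<and> t 3 = y \<and> t 8 = 1 \<and> t 9 = 0"
    then have "I t"
      using sweep_eq_sqf_part[OF N] N unfolding I_def y_def L by auto
    then have "runs f W (Loop 2 (block [gap_prog, strip_prog])) ((20 * W + 20 + 1) * t 2 + 1) t
        (\<lambda>u. I u \<and> u 2 = 0)"
      using body by (rule runs_Loop)
    then have "runs f W (Loop 2 (block [gap_prog, strip_prog])) ((20 * W + 20 + 1) * y ^ 3 + 1) t
        (\<lambda>u. I u \<and> u 2 = 0)"
      using t by simp
    then show "runs f W (block [Loop 2 (block [gap_prog, strip_prog])])
        (((20 * W + 20 + 1) * y ^ 3 + 1) + 1) t (\<lambda>u. u 0 = sqf_part N)"
      by (rule runs_block_Cons) (rule runs_block_Nil, auto simp: I_def)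
  qed
  then show ?thesis unfolding y_def [symmetric] by (rule runs_mono) simp_all
qed

theorem theorem6p3:
  shows "poly_time_reducible SDP MTP"
proof -
  \<comment> \<open>\<open>w\<close> is the word length W as a polynomial in L, and
    \<open>[:0, 0, 64:] ^ 4\<close> is \<open>range_bound\<close>.\<close>
  define w :: "nat poly" where "w = [:80, 24:]"
  define p :: "nat poly" where
    "p = ([:15, 4:] + (20 * w + 21) * ([:0, 0, 64:] ^ 4) ^ 3) * (4 * (w + 1)\<^sup>2)"
  have p: "poly p L = (4 * L + 15 + (20 * (80 + 24 * L) + 21) * range_bound L ^ 3) * unit_cost (80 + 24 * L)" for L
    by (simp add: p_def w_def unit_cost_def range_bound_def power2_eq_square algebra_simps)
  show ?thesis
    unfolding poly_time_reducible_def
  proof (intro exI[of _ sqf_prog] exI[of _ p] allI impI)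
    fix f xs y
    assume f: "solves f MTP" and xs: "SDP xs = Some y"
    then obtain N where N: "xs = [N]" "N > 0" "y = sqf_part N"
      by (auto simp: SDP_def split: list.splits if_splits)
    have "runs f (80 + 24 * bit_length N) sqf_prog
        (4 * bit_length N + 15 + (20 * (80 + 24 * bit_length N) + 21) * range_bound (bit_length N) ^ 3)
        (input_state [N]) (\<lambda>t. t 0 = sqf_part N)"
      by (rule runs_sqf_prog[OF f N(2) refl refl])
    then obtain t T qs where *: "exec f sqf_prog (input_state [N]) t T qs"
        "T \<le> poly p (bit_length N)" "t 0 = sqf_part N"
      unfolding runs_def p by blast
    have "length qs \<le> T" "\<forall>q\<in>set qs. bit_size q \<le> T"
      using exec_queries_bounded[OF *(1)] by auto
    then have "length qs \<le> poly p (bit_length N)"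
        "\<forall>q\<in>set qs. bit_size q \<le> poly p (bit_length N)"
      using *(2) by (blast intro: order_trans)+
    moreover have "bit_size xs = bit_length N" using N(1) by (simp add: bit_size_def)
    ultimately show "\<exists>t T qs. exec f sqf_prog (input_state xs) t T qs \<and> t 0 = y \<and>
        T \<le> poly p (bit_size xs) \<and> length qs \<le> poly p (bit_size xs) \<and>
        (\<forall>q\<in>set qs. bit_size q \<le> poly p (bit_size xs))"
      using * N(1,3) by (intro exI[of _ t] exI[of _ T] exI[of _ qs]) simp
  qed
qed

end
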